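(* Let $(E,d)$ be a complete separable metric space and let $\varphi$ be a white noise $E$-valued random dynamical system over $(\Omega,\mathcal F,\mathbb P,\theta)$ which is strongly mixing with respect to an invariant probability measure $\rho$ and which satisfies weak global pointwise stability (with respect to $\rho$). Then weak synchronization holds for $\varphi$.
   Context: White noise RDS. $(\Omega,\mathcal F,\mathbb P)$ is a probability space (not necessarily complete), $\theta=(\theta_t)_{t\in\mathbb R}$ is a group of jointly measurable maps on it with ergodic invariant measure $\mathbb P$. The map $\varphi:\mathbb R_+\times\Omega\times E\to E$ is a perfect cocycle: it is measurable, $\varphi_0(\omega,x)=x$ and $\varphi_{t+s}(\omega,x)=\varphi_t(\theta_s\omega,\varphi_s(\omega,x))$ for all $x\in E$, $s,t\ge 0$, $\omega\in\Omega$; and $x\mapsto\varphi_s(\omega,x)$ is continuous for all $s\ge0$, $\omega\in\Omega$. There are sub-$\sigma$-algebras $(\mathcal F_{s,t})_{-\infty<s\le t<\infty}$ of $\mathcal F$ with $\mathcal F_{t,u}\subseteq\mathcal F_{s,v}$ for $s\le t\le u\le v$, $\theta_r^{-1}(\mathcal F_{s,t})=\mathcal F_{s+r,t+r}$ for all $r,s,t$, and $\mathcal F_{t_0,t_1},\dots,\mathcal F_{t_{n-1},t_n}$ independent for all $t_0\le\dots\le t_n$. $\mathcal F_t$ is the $\sigma$-algebra generated by all $\mathcal F_{s,t}$, $s\le t$. It is assumed that $\varphi_s(\cdot,x)$ is $\mathcal F_{0,s}$-measurable for each $s\ge0$, $x\in E$. Markov semigroup: $P_tf(x):=\mathbb E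 f(\varphi_t(\cdot,x))$ for bounded measurable $f$; "invariant probability measure" means invariant for $(P_t)$. $\varphi$ is strongly mixing (with respect to $\rho$) if $P_tf(x)\to\int_E f\,d\rho$ as $t\to\infty$ for each bounded continuous $f$ and all $x\in E$, i.e. the law of $\varphi_t(\cdot,x)$ converges to $\rho$ for all $x\in E$. Weak global pointwise stability: there exist a (measurable) set $U\subseteq E$ with $\rho(U)=1$ and a sequence $t_n\uparrow\infty$ such that for all $x,y\in U$ there is $\delta=\delta(x,y)>0$ such that for all $\eta>0$: $\liminf_{n\to\infty}\mathbb P\big(d(\varphi_{t_n}(\cdot,x),\varphi_{t_n}(\cdot,y))\le\eta\big)\ge\delta(x,y)$. Weak synchronization: there exists an $\mathcal F_0$-measurable $E$-valued random variable $a$ such that (1) for all $t\ge0$, $\varphi_t(\omega,a(\omega))=a(\theta_t\omega)$ almost surely, and (2) for every $x\in E$, $d(\varphi_t(\theta_{-t}\omega,x),a(\omega))\to0$ in probability as $t\to\infty$. *)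

theory Defs
  imports "HOL-Probability.Probability"
begin

locale ergodic_metric_dynamical_system = prob_space M
  for M :: "'w measure" and \<theta> :: "real \<Rightarrow> 'w \<Rightarrow> 'w" +
  assumes flow_measurable: "(\<lambda>(t, \<omega>). \<theta> t \<omega>) \<in> borel \<Otimes>\<^sub>M M \<rightarrow>\<^sub>M M"
    and flow_zero: "\<And>\<omega>. \<omega> \<in> space M \<Longrightarrow> \<theta> 0 \<omega> = \<omega>"
    and flow_add: "\<And>s t \<omega>. \<omega> \<in> space M \<Longrightarrow> \<theta> (s + t) \<omega> = \<theta> s (\<theta> t \<omega>)"
    and flow_invariant: "\<And>t. distr M M (\<theta> t) = M"
    and flow_ergodic:
      "\<And>A. A \<in> sets M \<Longrightarrow> (\<forall>t. \<theta> t -` A \<inter> space M = A) \<Longrightarrow> prob A = 0 \<or> prob A = 1"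

text \<open>The sub-\<open>\<sigma>\<close>-algebras \<open>F s t\<close> are encoded as measures, of which only the space and the
  measurable sets matter; \<open>F s t\<close> is irrelevant for \<open>s > t\<close>. Likewise \<open>\<phi> t\<close> is irrelevant
  for \<open>t < 0\<close>.\<close>

locale white_noise_rds = ergodic_metric_dynamical_system M \<theta>
  for M :: "'w measure" and \<theta> :: "real \<Rightarrow> 'w \<Rightarrow> 'w" +
  fixes \<phi> :: "real \<Rightarrow> 'w \<Rightarrow> 'e::polish_space \<Rightarrow> 'e"
    and F :: "real \<Rightarrow> real \<Rightarrow> 'w measure"
  assumes cocycle_measurable:
      "(\<lambda>(t, \<omega>, x). \<phi> t \<omega> x) \<in> restrict_space borel {0..} \<Otimes>\<^sub>M M \<Otimes>\<^sub>M borel \<rightarrow>\<^sub>M borel"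
    and cocycle_zero: "\<And>\<omega> x. \<omega> \<in> space M \<Longrightarrow> \<phi> 0 \<omega> x = x"
    and cocycle_add:
      "\<And>s t \<omega> x. 0 \<le> s \<Longrightarrow> 0 \<le> t \<Longrightarrow> \<omega> \<in> space M \<Longrightarrow>
        \<phi> (t + s) \<omega> x = \<phi> t (\<theta> s \<omega>) (\<phi> s \<omega> x)"
    and cocycle_continuous:
      "\<And>s \<omega>. 0 \<le> s \<Longrightarrow> \<omega> \<in> space M \<Longrightarrow> continuous_on UNIV (\<lambda>x. \<phi> s \<omega> x)"
    and noise_subalgebra: "\<And>s t. s \<le> t \<Longrightarrow> subalgebra M (F s t)"
    and noise_mono:
      "\<And>s t u v. s \<le> t \<Longrightarrow> t \<le> u \<Longrightarrow> u \<le> v \<Longrightarrow> sets (F t u) \<subseteq> sets (F s v)"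
    and noise_shift:
      "\<And>r s t. s \<le> t \<Longrightarrow>
        (\<lambda>A. \<theta> r -` A \<inter> space M) ` sets (F s t) = sets (F (s + r) (t + r))"
    and noise_indep:
      "\<And>(n::nat) t. (\<forall>i<n. t i \<le> t (Suc i)) \<Longrightarrow>
        indep_sets (\<lambda>i. sets (F (t i) (t (Suc i)))) {..<n}"
    and cocycle_noise_measurable:
      "\<And>s x. 0 \<le> s \<Longrightarrow> (\<lambda>\<omega>. \<phi> s \<omega> x) \<in> F 0 s \<rightarrow>\<^sub>M borel"

definition past :: "'w measure \<Rightarrow> (real \<Rightarrow> real \<Rightarrow> 'w measure) \<Rightarrow> real \<Rightarrow> 'w measure" where
  "past M F t = sigma (space M) (\<Union>s\<in>{..t}. sets (F s t))"

definition markov_semigroup ::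
    "'w measure \<Rightarrow> (real \<Rightarrow> 'w \<Rightarrow> 'e \<Rightarrow> 'e) \<Rightarrow> real \<Rightarrow> ('e \<Rightarrow> real) \<Rightarrow> 'e \<Rightarrow> real" where
  "markov_semigroup M \<phi> t f x = (\<integral>\<omega>. f (\<phi> t \<omega> x) \<partial>M)"

definition invariant_prob ::
    "'w measure \<Rightarrow> (real \<Rightarrow> 'w \<Rightarrow> 'e::polish_space \<Rightarrow> 'e) \<Rightarrow> 'e measure \<Rightarrow> bool" where
  "invariant_prob M \<phi> \<rho> \<longleftrightarrow>
    prob_space \<rho> \<and> sets \<rho> = sets borel \<and>
    (\<forall>t\<ge>0. \<forall>f \<in> borel_measurable borel. bounded (range f) \<longrightarrow>
      (\<integral>x. markov_semigroup M \<phi> t f x \<partial>\<rho>) = (\<integral>x. f x \<partial>\<rho>))"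

definition strongly_mixing ::
    "'w measure \<Rightarrow> (real \<Rightarrow> 'w \<Rightarrow> 'e::polish_space \<Rightarrow> 'e) \<Rightarrow> 'e measure \<Rightarrow> bool" where
  "strongly_mixing M \<phi> \<rho> \<longleftrightarrow>
    (\<forall>f x. continuous_on UNIV f \<longrightarrow> bounded (range f) \<longrightarrow>
      ((\<lambda>t. markov_semigroup M \<phi> t f x) \<longlongrightarrow> (\<integral>y. f y \<partial>\<rho>)) at_top)"

definition weak_global_pointwise_stability ::
    "'w measure \<Rightarrow> (real \<Rightarrow> 'w \<Rightarrow> 'e::polish_space \<Rightarrow> 'e) \<Rightarrow> 'e measure \<Rightarrow> bool" where
  "weak_global_pointwise_stability M \<phi> \<rho> \<longleftrightarrow>
    (\<exists>U (\<tau> :: nat \<Rightarrow> real).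
      U \<in> sets borel \<and> measure \<rho> U = 1 \<and>
      (\<forall>n. 0 \<le> \<tau> n) \<and> incseq \<tau> \<and> filterlim \<tau> at_top sequentially \<and>
      (\<forall>x\<in>U. \<forall>y\<in>U. \<exists>\<delta>>0. \<forall>\<eta>>0.
        ereal \<delta> \<le>
          liminf (\<lambda>n. ereal (measure M {\<omega> \<in> space M. dist (\<phi> (\<tau> n) \<omega> x) (\<phi> (\<tau> n) \<omega> y) \<le> \<eta>}))))"

definition tendsto_in_prob ::
    "'w measure \<Rightarrow> ('i \<Rightarrow> 'w \<Rightarrow> real) \<Rightarrow> real \<Rightarrow> 'i filter \<Rightarrow> bool" where
  "tendsto_in_prob M X c G \<longleftrightarrow>
    (\<forall>\<epsilon>>0. ((\<lambda>i. measure M {\<omega> \<in> space M. \<bar>X i \<omega> - c\<bar> > \<epsilon>}) \<longlongrightarrow> 0) G)"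

text \<open>In the first clause the exceptional null set may depend on \<open>t\<close>.\<close>

definition weak_synchronization ::
    "'w measure \<Rightarrow> (real \<Rightarrow> 'w \<Rightarrow> 'w) \<Rightarrow> (real \<Rightarrow> 'w \<Rightarrow> 'e::polish_space \<Rightarrow> 'e) \<Rightarrow>
      (real \<Rightarrow> real \<Rightarrow> 'w measure) \<Rightarrow> bool" where
  "weak_synchronization M \<theta> \<phi> F \<longleftrightarrow>
    (\<exists>a \<in> past M F 0 \<rightarrow>\<^sub>M borel.
      (\<forall>t\<ge>0. AE \<omega> in M. \<phi> t \<omega> (a \<omega>) = a (\<theta> t \<omega>)) \<and>
      (\<forall>x. tendsto_in_prob M (\<lambda>t \<omega>. dist (\<phi> t (\<theta> (- t) \<omega>) x) (a \<omega>)) 0 at_top))"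

end

theory Submission
  imports Defs
begin

text \<open>
  The trajectories that start in a fixed point at time \<open>- t\<close> and are observed at time \<open>0\<close> turn out
  to be Cauchy in probability as \<open>t\<close> grows, and their limit is the random point \<open>a\<close>. The reason is that
  two points moving with the same noise approach each other in probability.

  Let \<open>Q t\<close> be the law at time \<open>t\<close> of two points that start independently with law \<open>\<rho>\<close>. Given the noise,
  the points are independent with a common random law \<open>\<mu>\<close>, so that \<open>Q t\<close> is the mean of \<open>\<mu> \<times> \<mu>\<close>. Looked at
  backwards in time, \<open>\<mu>\<close> is a measure-valued martingale. What is used of this is only that second moments
  increase (\<open>second_moment_mono\<close>), whence \<open>Q t (A \<times> B)\<close> converges for all Borel sets \<open>A\<close> and \<open>B\<close>. All \<open>Q t\<close>
  have both marginals equal to \<open>\<rho>\<close>, and this makes the limit of the rectangle masses a measure \<open>R\<close> and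
  the convergence weak (\<open>couplings_converge_weakly\<close>).

  The coupling \<open>R\<close> is invariant for the two-point motion. The diagonal is absorbing, so by invariance no mass
  moves from off the diagonal to the diagonal, not even asymptotically. Weak pointwise stability,
  which applies to \<open>R\<close>-almost every pair since the marginals of \<open>R\<close> are \<open>\<rho>\<close>, says that from each such pair a
  positive mass does get arbitrarily close to the diagonal along a sequence of times. Hence \<open>R\<close> is
  concentrated on the diagonal (\<open>invariant_coupling_diagonal\<close>): stationary points synchronize.

  Strong mixing extends this to arbitrary starting points. The mean distance between the trajectories of two
  points is at most the sum of their mean distances to a stationary point, and the mean of this
  distance function under the law of \<open>\<phi> r\<close> started in \<open>x\<close> converges to its stationary mean, which is small
  (\<open>mean_gap_tendsto_0\<close>). The same estimate compares a starting time with a much earlier one, which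
  yields the Cauchy property (\<open>pullback_Cauchy\<close>).
\<close>

section \<open>Weak limits of couplings\<close>

definition coupling :: "'a::polish_space measure \<Rightarrow> ('a \<times> 'a) measure \<Rightarrow> bool" where
  "coupling \<rho> Q \<longleftrightarrow> prob_space Q \<and> sets Q = sets borel \<and>
    (\<forall>A\<in>sets borel. measure Q (A \<times> UNIV) = measure \<rho> A \<and> measure Q (UNIV \<times> A) = measure \<rho> A)"

text \<open>Inner and outer regularity of finite Borel measures on Polish spaces, in the form in which an
  explicit error \<open>e\<close> can be carried through estimates.\<close>

lemma compact_inner_approximation:
  fixes \<rho> :: "'a::polish_space measure"
  assumes "finite_measure \<rho>" and s: "sets \<rho> = sets borel" and A: "A \<in> sets borel" and e: "0 < e"
  obtains K where "K \<subseteq> A" "compact K" "measure \<rho> A < measure \<rho> K + e"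
proof (rule ccontr)
  note obtain_rule = that
  interpret finite_measure \<rho> by fact
  assume neg: "\<not> thesis"
  have *: "measure \<rho> K + e \<le> measure \<rho> A" if K: "K \<subseteq> A" "compact K" for K
  proof (rule ccontr)
    assume "\<not> measure \<rho> K + e \<le> measure \<rho> A"
    then show False using neg obtain_rule[OF K] by simp
  qed
  have "e \<le> measure \<rho> A" using *[of "{}"] by auto
  have "emeasure \<rho> A = (SUP K \<in> {K. K \<subseteq> A \<and> compact K}. emeasure \<rho> K)"
    by (rule inner_regular[OF s _ A]) auto
  also have "\<dots> \<le> ennreal (measure \<rho> A - e)"
    using * by (intro SUP_least) (auto simp: emeasure_eq_measure intro!: ennreal_leI simp: le_diff_eq)
  finally show False
    using e \<open>e \<le> measure \<rho> A\<close> by (simp add: emeasure_eq_measure)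
qed

lemma open_outer_approximation:
  fixes \<rho> :: "'a::polish_space measure"
  assumes "finite_measure \<rho>" and s: "sets \<rho> = sets borel" and A: "A \<in> sets borel" and e: "0 < e"
  obtains U where "A \<subseteq> U" "open U" "measure \<rho> (U - A) < e"
proof -
  interpret finite_measure \<rho> by fact
  obtain K where K: "K \<subseteq> - A" "compact K" "measure \<rho> (- A) < measure \<rho> K + e"
    using compact_inner_approximation[OF assms(1) s _ e, of "- A"] A by auto
  have "closed K" using K(2) by (rule compact_imp_closed)
  have "measure \<rho> (- K - A) = measure \<rho> (- A - K)"
    by (rule arg_cong[where f="measure \<rho>"]) auto
  also have "\<dots> = measure \<rho> (- A) - measure \<rho> K"
    using A K \<open>closed K\<close> s by (intro finite_measure_Diff) auto
  finally show thesis
    using K \<open>closed K\<close> by (intro that[of "- K"]) auto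
qed

lemma sets_Times_borel [measurable]:
  fixes A :: "'a::second_countable_topology set" and B :: "'b::second_countable_topology set"
  assumes "A \<in> sets borel" "B \<in> sets borel"
  shows "A \<times> B \<in> sets borel"
  using assms by (simp add: borel_prod[symmetric])

abbreviation borel_rectangles :: "('a::topological_space \<times> 'a) set set" where
  "borel_rectangles \<equiv> {A \<times> B |A B. A \<in> sets borel \<and> B \<in> sets borel}"

lemma semiring_borel_rectangles: "semiring_of_sets UNIV (borel_rectangles :: ('a::topological_space \<times> 'a) set set)"
proof
  show "{} \<in> (borel_rectangles :: ('a \<times> 'a) set set)" by blast
next
  fix a b :: "('a \<times> 'a) set"
  assume "a \<in> borel_rectangles" "b \<in> borel_rectangles"
  then obtain A B C D where *: "a = A \<times> B" "b = C \<times> D"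
    "A \<in> sets borel" "B \<in> sets borel" "C \<in> sets borel" "D \<in> sets borel" by auto
  show "a \<inter> b \<in> borel_rectangles"
    unfolding * Times_Int_Times using * by blast
  show "\<exists>X\<subseteq>borel_rectangles. finite X \<and> disjoint X \<and> a - b = \<Union> X"
  proof (intro exI conjI)
    let ?X = "{(A - C) \<times> B, (A \<inter> C) \<times> (B - D)}"
    show "?X \<subseteq> borel_rectangles" using * by auto
    show "disjoint ?X" by (auto simp: disjoint_def)
    show "a - b = \<Union> ?X" unfolding * by auto
  qed auto
qed auto

lemma sigma_sets_borel_rectangles:
  "sigma_sets UNIV (borel_rectangles :: ('a::second_countable_topology \<times> 'a) set set) = sets borel"
  unfolding borel_prod[symmetric] sets_pair_measure by simp

text \<open>A limit of couplings on rectangles is automatically \<open>\<sigma>\<close>-additive, although the limit of a net of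
  measures in general is not: since the marginals never change, replacing the sides of a rectangle
  by compact or open sets costs an error that does not depend on \<open>i\<close>. Countable covers of a rectangle
  by rectangles therefore reduce to finite covers by compactness, and Caratheodory's theorem gives
  a measure.\<close>

lemma couplings_extend:
  fixes \<rho> :: "'a::polish_space measure" and Q :: "'i \<Rightarrow> ('a \<times> 'a) measure"
  assumes \<rho>: "prob_space \<rho>" "sets \<rho> = sets borel" and G: "G \<noteq> bot"
    and Q: "\<And>i. coupling \<rho> (Q i)"
    and lim: "\<And>A B. A \<in> sets borel \<Longrightarrow> B \<in> sets borel \<Longrightarrow>
       ((\<lambda>i. measure (Q i) (A \<times> B)) \<longlongrightarrow> q (A \<times> B)) G"
  shows "\<exists>R. coupling \<rho> R \<and> (\<forall>A\<in>sets borel. \<forall>B\<in>sets borel. measure R (A \<times> B) = q (A \<times> B))"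
proof -
  interpret \<rho>: prob_space \<rho> by fact
  have Qp: "prob_space (Q i)" and Qs [measurable_cong, simp]: "sets (Q i) = sets borel" for i
    using Q[of i] by (auto simp: coupling_def)
  have Qm: "measure (Q i) (A \<times> UNIV) = measure \<rho> A" "measure (Q i) (UNIV \<times> A) = measure \<rho> A"
    if "A \<in> sets borel" for A i
    using Q[of i] that by (auto simp: coupling_def)
  have Qfin: "finite_measure (Q i)" for i
    using Qp by (simp add: prob_space_def)
  have nonneg: "0 \<le> q (A \<times> B)" if "A \<in> sets borel" "B \<in> sets borel" for A B
    by (rule tendsto_lowerbound[OF lim[OF that] _ G]) auto
  have sub: "q (A \<times> B) \<le> (\<Sum>n\<in>I. q (C n \<times> D n))"
    if "A \<in> sets borel" "B \<in> sets borel" "\<And>n::nat. C n \<in> sets borel" "\<And>n. D n \<in> sets borel"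
      "finite I" "A \<times> B \<subseteq> (\<Union>n\<in>I. C n \<times> D n)" for A B C D I
  proof (rule tendsto_le[OF G _ lim])
    show "((\<lambda>i. \<Sum>n\<in>I. measure (Q i) (C n \<times> D n)) \<longlongrightarrow> (\<Sum>n\<in>I. q (C n \<times> D n))) G"
      using that by (intro tendsto_sum lim)
    have "measure (Q i) (A \<times> B) \<le> (\<Sum>n\<in>I. measure (Q i) (C n \<times> D n))" for i
    proof -
      have "measure (Q i) (A \<times> B) \<le> measure (Q i) (\<Union>n\<in>I. C n \<times> D n)"
        using that by (intro finite_measure.finite_measure_mono[OF Qfin]) auto
      also have "\<dots> \<le> (\<Sum>n\<in>I. measure (Q i) (C n \<times> D n))"
        using that by (intro finite_measure.finite_measure_subadditive_finite[OF Qfin]) auto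
      finally show ?thesis .
    qed
    then show "\<forall>\<^sub>F i in G. measure (Q i) (A \<times> B) \<le> (\<Sum>n\<in>I. measure (Q i) (C n \<times> D n))" by simp
  qed (use that in auto)
  have super: "(\<Sum>n<N. q (C n \<times> D n)) \<le> q (A \<times> B)"
    if "A \<in> sets borel" "B \<in> sets borel" "\<And>n::nat. C n \<in> sets borel" "\<And>n. D n \<in> sets borel"
      "disjoint_family (\<lambda>n. C n \<times> D n)" "(\<Union>n. C n \<times> D n) \<subseteq> A \<times> B" for A B C D N
  proof (rule tendsto_le[OF G lim])
    show "((\<lambda>i. \<Sum>n<N. measure (Q i) (C n \<times> D n)) \<longlongrightarrow> (\<Sum>n<N. q (C n \<times> D n))) G"
      using that by (intro tendsto_sum lim)
    have "(\<Sum>n<N. measure (Q i) (C n \<times> D n)) \<le> measure (Q i) (A \<times> B)" for i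
    proof -
      have "(\<Sum>n<N. measure (Q i) (C n \<times> D n)) = measure (Q i) (\<Union>n<N. C n \<times> D n)"
        using that by (intro finite_measure.finite_measure_finite_Union[OF Qfin, symmetric])
          (auto simp: disjoint_family_on_def)
      also have "\<dots> \<le> measure (Q i) (A \<times> B)"
        by (rule finite_measure.finite_measure_mono[OF Qfin], rule subset_trans[OF _ that(6)])
          (use that(1,2) in auto)
      finally show ?thesis .
    qed
    then show "\<forall>\<^sub>F i in G. (\<Sum>n<N. measure (Q i) (C n \<times> D n)) \<le> measure (Q i) (A \<times> B)" by simp
  qed (use that in auto)
  \<comment> \<open>The regularity error is controlled by \<open>\<rho>\<close> alone, uniformly in \<open>i\<close>.\<close>
  have approx: "q (U \<times> V) \<le> q (A \<times> B) + measure \<rho> (U - A) + measure \<rho> (V - B)"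
    if [measurable]: "A \<in> sets borel" "B \<in> sets borel" "U \<in> sets borel" "V \<in> sets borel" for A B U V
  proof (rule tendsto_le[OF G _ lim])
    show "((\<lambda>i. measure (Q i) (A \<times> B) + measure \<rho> (U - A) + measure \<rho> (V - B)) \<longlongrightarrow>
       q (A \<times> B) + measure \<rho> (U - A) + measure \<rho> (V - B)) G"
      using that by (intro tendsto_intros lim)
    have "measure (Q i) (U \<times> V) \<le> measure (Q i) (A \<times> B) + measure \<rho> (U - A) + measure \<rho> (V - B)" for i
    proof -
      interpret finite_measure "Q i" by (rule Qfin)
      have "measure (Q i) (U \<times> V) \<le> measure (Q i) ((A \<times> B) \<union> (U - A) \<times> UNIV \<union> UNIV \<times> (V - B))"
        by (intro finite_measure_mono) auto
      also have "\<dots> \<le> measure (Q i) ((A \<times> B) \<union> (U - A) \<times> UNIV) + measure (Q i) (UNIV \<times> (V - B))"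
        by (intro measure_Un_le) auto
      also have "measure (Q i) ((A \<times> B) \<union> (U - A) \<times> UNIV) \<le> measure (Q i) (A \<times> B) + measure (Q i) ((U - A) \<times> UNIV)"
        by (intro measure_Un_le) auto
      finally show ?thesis by (simp add: Qm)
    qed
    then show "\<forall>\<^sub>F i in G. measure (Q i) (U \<times> V) \<le> measure (Q i) (A \<times> B) + measure \<rho> (U - A) + measure \<rho> (V - B)" by simp
  qed (use that in auto)

  have sums: "(\<lambda>n. q (C n \<times> D n)) sums q (A \<times> B)"
    if AB[measurable]: "A \<in> sets borel" "B \<in> sets borel"
      and CD[measurable]: "\<And>n::nat. C n \<in> sets borel" "\<And>n. D n \<in> sets borel"
      and dis: "disjoint_family (\<lambda>n. C n \<times> D n)" and un: "(\<Union>n. C n \<times> D n) = A \<times> B" for A B C D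
  proof -
    have le: "(\<Sum>n<N. q (C n \<times> D n)) \<le> q (A \<times> B)" for N
      by (rule super[OF AB CD dis]) (use un in auto)
    have summ: "summable (\<lambda>n. q (C n \<times> D n))"
      by (rule summableI_nonneg_bounded[OF _ le]) (intro nonneg CD)
    have "(\<Sum>n. q (C n \<times> D n)) \<le> q (A \<times> B)"
      by (rule suminf_le_const[OF summ le])
    \<comment> \<open>Passing from \<open>A \<times> B\<close> to a compact rectangle costs \<open>2 e\<close>; enlarging all \<open>C n \<times> D n\<close> to open
      rectangles costs \<open>(\<Sum>n. 2 e / 2 ^ n) = 4 e\<close>.\<close>
    have *: "q (A \<times> B) \<le> (\<Sum>n. q (C n \<times> D n)) + 6 * e" if e: "0 < e" for e
    proof -
      obtain K where K: "K \<subseteq> A" "compact K" "measure \<rho> A < measure \<rho> K + e"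
        by (rule compact_inner_approximation[OF \<rho>.finite_measure_axioms \<rho>(2) AB(1) e])
      obtain L where L: "L \<subseteq> B" "compact L" "measure \<rho> B < measure \<rho> L + e"
        by (rule compact_inner_approximation[OF \<rho>.finite_measure_axioms \<rho>(2) AB(2) e])
      have [measurable]: "K \<in> sets borel" "L \<in> sets borel"
        using K(2) L(2) by (auto intro: borel_compact)
      have en: "0 < e * (1/2) ^ n" for n :: nat using e by simp
      have "\<exists>U. C n \<subseteq> U \<and> open U \<and> measure \<rho> (U - C n) < e * (1/2) ^ n" for n
        by (rule open_outer_approximation[OF \<rho>.finite_measure_axioms \<rho>(2) CD(1)[of n] en[of n]]) blast
      then obtain U where U: "\<And>n. C n \<subseteq> U n" "\<And>n. open (U n)" "\<And>n. measure \<rho> (U n - C n) < e * (1/2) ^ n"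
        by metis
      have "\<exists>V. D n \<subseteq> V \<and> open V \<and> measure \<rho> (V - D n) < e * (1/2) ^ n" for n
        by (rule open_outer_approximation[OF \<rho>.finite_measure_axioms \<rho>(2) CD(2)[of n] en[of n]]) blast
      then obtain V where V: "\<And>n. D n \<subseteq> V n" "\<And>n. open (V n)" "\<And>n. measure \<rho> (V n - D n) < e * (1/2) ^ n"
        by metis
      have [measurable]: "U n \<in> sets borel" "V n \<in> sets borel" for n
        using U(2) V(2) by auto
      have "K \<times> L \<subseteq> (\<Union>n\<in>UNIV. U n \<times> V n)"
      proof -
        have "K \<times> L \<subseteq> (\<Union>n. C n \<times> D n)" unfolding un using K(1) L(1) by blast
        also have "\<dots> \<subseteq> (\<Union>n. U n \<times> V n)" using U(1) V(1) by blast
        finally show ?thesis .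
      qed
      then obtain I where I: "finite I" "K \<times> L \<subseteq> (\<Union>n\<in>I. U n \<times> V n)"
        by (rule compactE_image[OF compact_Times[OF K(2) L(2)], rotated])
          (auto intro!: open_Times U(2) V(2))
      have "measure \<rho> (A - K) \<le> e" "measure \<rho> (B - L) \<le> e"
        using K L by (simp_all add: \<rho>.finite_measure_Diff \<rho>(2))
      then have 1: "q (A \<times> B) \<le> q (K \<times> L) + 2 * e"
        using approx[of K L A B] by simp
      have g: "summable (\<lambda>n. (1/2::real) ^ n)" by (rule summable_geometric) simp
      have "q (K \<times> L) \<le> (\<Sum>n\<in>I. q (U n \<times> V n))"
        using I by (intro sub) auto
      also have "\<dots> \<le> (\<Sum>n\<in>I. q (C n \<times> D n) + 2 * e * (1/2) ^ n)"
      proof (rule sum_mono)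
        fix n
        show "q (U n \<times> V n) \<le> q (C n \<times> D n) + 2 * e * (1/2) ^ n"
          using approx[of "C n" "D n" "U n" "V n"] U(3)[of n] V(3)[of n] by simp
      qed
      also have "\<dots> \<le> (\<Sum>n. q (C n \<times> D n) + 2 * e * (1/2) ^ n)"
        using I e by (intro sum_le_suminf summable_add summ summable_mult g)
          (auto intro!: add_nonneg_nonneg nonneg)
      also have "\<dots> = (\<Sum>n. q (C n \<times> D n)) + 2 * e * (\<Sum>n. (1/2) ^ n)"
        unfolding suminf_add[OF summ summable_mult[OF g], symmetric] suminf_mult[OF g] ..
      finally show ?thesis
        using 1 suminf_geometric[of "1/2::real"] by simp
    qed
    have "q (A \<times> B) \<le> (\<Sum>n. q (C n \<times> D n))"
    proof (rule field_le_epsilon)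
      fix e :: real assume "0 < e"
      then show "q (A \<times> B) \<le> (\<Sum>n. q (C n \<times> D n)) + e"
        using *[of "e / 6"] by simp
    qed
    with \<open>(\<Sum>n. q (C n \<times> D n)) \<le> q (A \<times> B)\<close> show ?thesis
      using summ by (simp add: sums_iff)
  qed

  interpret R: semiring_of_sets UNIV "borel_rectangles :: ('a \<times> 'a) set set"
    by (rule semiring_borel_rectangles)
  have "q {} = 0"
    using tendsto_unique[OF G lim[of "{}" "{}"], of 0] by simp
  then have "positive borel_rectangles (\<lambda>S. ennreal (q S))"
    by (simp add: positive_def)
  moreover have "countably_additive borel_rectangles (\<lambda>S. ennreal (q S))"
  proof (rule countably_additiveI)
    fix S :: "nat \<Rightarrow> ('a \<times> 'a) set"
    assume S: "range S \<subseteq> borel_rectangles" "disjoint_family S" "\<Union> (range S) \<in> borel_rectangles"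
    have "\<forall>n. \<exists>A B. S n = A \<times> B \<and> A \<in> sets borel \<and> B \<in> sets borel"
    proof
      fix n
      have "S n \<in> borel_rectangles" using S(1) by (rule subsetD) simp
      then show "\<exists>A B. S n = A \<times> B \<and> A \<in> sets borel \<and> B \<in> sets borel" by (rule CollectD)
    qed
    then obtain C D where CD: "\<And>n. S n = C n \<times> D n" "\<And>n. C n \<in> sets borel" "\<And>n. D n \<in> sets borel"
      by metis
    obtain A B where AB: "\<Union> (range S) = A \<times> B" "A \<in> sets borel" "B \<in> sets borel"
      using S(3) by auto
    have "(\<lambda>n. q (C n \<times> D n)) sums q (A \<times> B)"
      using S(2) AB CD(2,3) unfolding CD(1)[abs_def] by (intro sums) auto
    then show "(\<Sum>n. ennreal (q (S n))) = ennreal (q (\<Union> (range S)))"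
      unfolding AB(1) CD(1) by (intro suminf_ennreal_eq nonneg CD)
  qed
  ultimately obtain \<mu> where \<mu>: "\<And>S. S \<in> borel_rectangles \<Longrightarrow> \<mu> S = ennreal (q S)"
    "measure_space UNIV (sets borel) \<mu>"
    using R.caratheodory[of "\<lambda>S. ennreal (q S)"] unfolding sigma_sets_borel_rectangles by auto
  define R where "R = measure_of UNIV (sets borel) \<mu>"
  have sR: "sets R = sets borel" unfolding R_def by (simp add: sets.sigma_sets_eq[of borel, simplified])
  have eR: "emeasure R S = \<mu> S" if "S \<in> sets borel" for S
    unfolding R_def using \<mu>(2) that
    by (intro emeasure_measure_of_sigma) (auto simp: measure_space_def)
  have mR: "measure R (A \<times> B) = q (A \<times> B)" if "A \<in> sets borel" "B \<in> sets borel" for A B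
  proof -
    have "A \<times> B \<in> borel_rectangles" using that by blast
    with that eR[of "A \<times> B"] \<mu>(1)[of "A \<times> B"] nonneg[of A B] show ?thesis
      by (simp add: measure_def)
  qed
  have qm: "q (A \<times> UNIV) = measure \<rho> A" "q (UNIV \<times> A) = measure \<rho> A" if "A \<in> sets borel" for A
    using tendsto_unique[OF G lim[of A UNIV], of "measure \<rho> A"]
      tendsto_unique[OF G lim[of UNIV A], of "measure \<rho> A"] that by (simp_all add: Qm)
  have "measure \<rho> UNIV = 1"
    using \<rho>.prob_space sets_eq_imp_space_eq[OF \<rho>(2)] by simp
  moreover have "(UNIV :: ('a \<times> 'a) set) \<in> borel_rectangles"
    by (rule CollectI, intro exI[of _ UNIV]) simp
  ultimately have "emeasure R (space R) = 1"
    using eR[of UNIV] \<mu>(1)[of UNIV] qm(1)[of UNIV] sets_eq_imp_space_eq[OF sR] by simp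
  then have "prob_space R" by (rule prob_spaceI)
  then show ?thesis
    using sR by (intro exI[of _ R]) (simp add: coupling_def mR qm)
qed

text \<open>Inclusion-exclusion, using that rectangles are stable under intersection.\<close>

lemma rectangle_limits_imp_finite_union_limit:
  fixes R :: "('a::polish_space \<times> 'a) measure" and Q :: "'i \<Rightarrow> ('a \<times> 'a) measure"
  assumes Q: "\<And>i. finite_measure (Q i)" "\<And>i. sets (Q i) = sets borel"
    and R: "finite_measure R" "sets R = sets borel"
    and lim: "\<And>A B. A \<in> sets borel \<Longrightarrow> B \<in> sets borel \<Longrightarrow>
       ((\<lambda>i. measure (Q i) (A \<times> B)) \<longlongrightarrow> measure R (A \<times> B)) G"
    and "\<And>k::nat. A k \<in> sets borel" "\<And>k. B k \<in> sets borel"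
  shows "((\<lambda>i. measure (Q i) (\<Union>k<n. A k \<times> B k)) \<longlongrightarrow> measure R (\<Union>k<n. A k \<times> B k)) G"
  using assms(6,7)
proof (induction n arbitrary: A B)
  case 0
  then show ?case by simp
next
  case (Suc n)
  have m: "(\<Union>k<n. A k \<times> B k) \<in> sets borel" "(\<Union>k<n. (A k \<inter> A n) \<times> (B k \<inter> B n)) \<in> sets borel" "A n \<times> B n \<in> sets borel"
    using Suc.prems by auto
  have eq: "measure P (\<Union>k<Suc n. A k \<times> B k) =
      measure P (\<Union>k<n. A k \<times> B k) + measure P (A n \<times> B n) - measure P (\<Union>k<n. (A k \<inter> A n) \<times> (B k \<inter> B n))"
    if "finite_measure P" "sets P = sets borel" for P :: "('a \<times> 'a) measure"
  proof -
    interpret finite_measure P by fact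
    have "(\<Union>k<Suc n. A k \<times> B k) = (\<Union>k<n. A k \<times> B k) \<union> A n \<times> B n"
      by (auto simp: less_Suc_eq)
    moreover have "(\<Union>k<n. A k \<times> B k) \<inter> A n \<times> B n = (\<Union>k<n. (A k \<inter> A n) \<times> (B k \<inter> B n))"
      by auto
    ultimately show ?thesis
      using m that by (simp add: measure_Un3 fmeasurable_eq_sets)
  qed
  show ?case
    unfolding eq[OF Q] eq[OF R]
    using Suc.prems by (intro tendsto_intros Suc.IH lim) auto
qed

lemma open_eq_Union_rectangles:
  fixes S :: "('a::second_countable_topology \<times> 'a) set"
  assumes "open S"
  obtains A B where "\<And>k::nat. open (A k)" "\<And>k. open (B k)" "S = (\<Union>k. A k \<times> B k)"
proof -
  obtain b :: "'a set set" where b: "countable b" "topological_basis b"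
    using ex_countable_basis by auto
  have "topological_basis ((\<lambda>(a, b). a \<times> b) ` (b \<times> b))"
    by (intro topological_basis_prod b)
  then obtain X where X: "X \<subseteq> (\<lambda>(a, b). a \<times> b) ` (b \<times> b)" "\<Union> X = S"
    using assms by (auto simp: topological_basis_def)
  have "countable X"
    by (rule countable_subset[OF X(1)]) (use b in auto)
  have "X \<subseteq> {A \<times> B |A B. open A \<and> open B}"
  proof
    fix x assume "x \<in> X"
    with X(1) have "x \<in> (\<lambda>(a, b). a \<times> b) ` (b \<times> b)" by (rule subsetD)
    then obtain A B where "A \<in> b" "B \<in> b" "x = A \<times> B" by auto
    then show "x \<in> {A \<times> B |A B. open A \<and> open B}"
      using topological_basis_open[OF b(2)] by blast
  qed
  moreover have "{} \<in> {A \<times> B |A B :: 'a set. open A \<and> open B}"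
    by (rule CollectI, rule exI[of _ "{}"]) auto
  ultimately have sub: "insert {} X \<subseteq> {A \<times> B |A B. open A \<and> open B}" by simp
  have "\<forall>k. \<exists>A B. from_nat_into (insert {} X) k = A \<times> B \<and> open A \<and> open B"
  proof
    fix k
    have "from_nat_into (insert {} X) k \<in> insert {} X" by (rule from_nat_into) simp
    with sub have "from_nat_into (insert {} X) k \<in> {A \<times> B |A B. open A \<and> open B}" by (rule subsetD)
    then show "\<exists>A B. from_nat_into (insert {} X) k = A \<times> B \<and> open A \<and> open B" by (rule CollectD)
  qed
  then obtain A B where AB: "\<And>k. from_nat_into (insert {} X) k = A k \<times> B k" "\<And>k. open (A k)" "\<And>k. open (B k)"
    by metis
  have "S = \<Union> (insert {} X)" using X by simp
  also have "\<dots> = (\<Union>k. A k \<times> B k)"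
    unfolding AB(1)[symmetric] using range_from_nat_into[of "insert {} X"] \<open>countable X\<close> by simp
  finally show thesis using AB by (intro that)
qed

text \<open>An open set is an increasing limit of finite unions of rectangles, on each of which the masses
  converge. This gives the open-set half of the portmanteau theorem.\<close>

lemma rectangle_limits_imp_open_liminf:
  fixes R :: "('a::polish_space \<times> 'a) measure" and Q :: "'i \<Rightarrow> ('a \<times> 'a) measure"
  assumes Q: "\<And>i. finite_measure (Q i)" "\<And>i. sets (Q i) = sets borel"
    and R: "finite_measure R" "sets R = sets borel"
    and lim: "\<And>A B. A \<in> sets borel \<Longrightarrow> B \<in> sets borel \<Longrightarrow>
       ((\<lambda>i. measure (Q i) (A \<times> B)) \<longlongrightarrow> measure R (A \<times> B)) G"
    and S: "open S" and e: "0 < e"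
  shows "\<forall>\<^sub>F i in G. measure R S - e < measure (Q i) S"
proof -
  obtain A B where AB: "\<And>k::nat. open (A k)" "\<And>k. open (B k)" and S_eq: "S = (\<Union>k. A k \<times> B k)"
    using open_eq_Union_rectangles[OF S] by metis
  let ?C = "\<lambda>n. \<Union>k<n. A k \<times> B k"
  have "(\<lambda>n. measure R (?C n)) \<longlonglongrightarrow> measure R (\<Union>n. ?C n)"
    using AB R by (intro finite_measure.finite_Lim_measure_incseq)
      (auto simp: incseq_def dest: order_less_le_trans)
  moreover have "(\<Union>n. ?C n) = S"
    unfolding S_eq by (auto simp: lessThan_Suc_atMost[symmetric] intro: lessI)
  ultimately have "\<forall>\<^sub>F n in sequentially. measure R S - e / 2 < measure R (?C n)"
    using e by (intro order_tendstoD(1)[where y="measure R S"]) auto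
  then obtain n where n: "measure R S - e / 2 < measure R (?C n)"
    using eventually_sequentially by auto
  have "((\<lambda>i. measure (Q i) (?C n)) \<longlongrightarrow> measure R (?C n)) G"
    using AB by (intro rectangle_limits_imp_finite_union_limit[OF Q R lim]) auto
  then have "\<forall>\<^sub>F i in G. measure R (?C n) - e / 2 < measure (Q i) (?C n)"
    using e by (intro order_tendstoD(1)[where y="measure R (?C n)"]) auto
  then show ?thesis
  proof eventually_elim
    case (elim i)
    have "measure (Q i) (?C n) \<le> measure (Q i) S"
      using AB S Q by (intro finite_measure.finite_measure_mono) (auto simp: S_eq)
    with elim n show ?case by simp
  qed
qed

text \<open>The layer-cake argument with \<open>N\<close> levels: \<open>f\<close> differs by at most \<open>1 / N\<close> from the average of the
  indicators of the open sets \<open>{f > k / N}\<close>, \<open>k < N\<close>.\<close>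

lemma open_liminf_imp_integral_liminf:
  fixes R :: "'b::topological_space measure" and Q :: "'i \<Rightarrow> 'b measure"
  assumes Q: "\<And>i. prob_space (Q i)" "\<And>i. sets (Q i) = sets borel"
    and R: "prob_space R" "sets R = sets borel"
    and open_lim: "\<And>S e. open S \<Longrightarrow> 0 < e \<Longrightarrow> \<forall>\<^sub>F i in G. measure R S - e < measure (Q i) S"
    and f: "continuous_on UNIV f" "\<And>z. 0 \<le> f z" "\<And>z. f z \<le> (1::real)" and e: "0 < e"
  shows "\<forall>\<^sub>F i in G. (\<integral>z. f z \<partial>R) - e < (\<integral>z. f z \<partial>Q i)"
proof -
  obtain N :: nat where N: "1 / real N < e / 2" "0 < N"
    using real_arch_invD[of "e/2"] e by (auto simp: inverse_eq_divide)
  let ?S = "\<lambda>k. {z. real k / N < f z}"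
  have S: "open (?S k)" for k
    using f(1) by (auto intro: open_Collect_less continuous_on_const)
  have [measurable]: "f \<in> borel_measurable borel"
    using f(1) by (rule borel_measurable_continuous_onI)
  let ?s = "\<lambda>z. (1 / N) * (\<Sum>k<N. indicator (?S k) z)"
  have s: "f z \<le> ?s z" "?s z \<le> f z + 1 / N" for z
  proof -
    have "(\<Sum>k<N. indicator (?S k) z) = real (card {k\<in>{..<N}. real k / N < f z})"
      by (simp add: indicator_def sum.If_cases Int_def)
    also have "{k\<in>{..<N}. real k / N < f z} = {..<nat \<lceil>f z * N\<rceil>}"
    proof -
      have "k < N" if "k < f z * N" for k :: nat
      proof -
        have "f z * N \<le> 1 * real N" using f(3) by (intro mult_right_mono) auto
        with that show ?thesis by linarith
      qed
      then show ?thesis using N(2) by (auto simp: field_simps zless_nat_eq_int_zless less_ceiling_iff)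
    qed
    finally have *: "(\<Sum>k<N. indicator (?S k) z) = real (nat \<lceil>f z * N\<rceil>)" by simp
    have **: "f z * N \<le> real (nat \<lceil>f z * N\<rceil>)" "real (nat \<lceil>f z * N\<rceil>) \<le> f z * N + 1"
      using f(2)[of z] ceiling_correct[of "f z * N"] by (auto intro!: real_nat_ceiling_ge simp: of_nat_nat)
    show "f z \<le> ?s z" "?s z \<le> f z + 1 / N"
      unfolding * using ** N(2) by (auto simp: field_simps)
  qed
  have int: "(\<integral>z. ?s z \<partial>P) = (1 / N) * (\<Sum>k<N. measure P (?S k))"
    and ints: "integrable P ?s" and intf: "integrable P f"
    if "prob_space P" and [measurable_cong]: "sets P = sets borel" for P :: "'b measure"
  proof -
    interpret prob_space P by fact
    have S': "?S k \<in> sets P" for k using S that by auto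
    show "(\<integral>z. ?s z \<partial>P) = (1 / N) * (\<Sum>k<N. measure P (?S k))"
      using S' sets.sets_into_space[OF S']
      by (subst integral_mult_right_zero, subst Bochner_Integration.integral_sum)
        (auto simp: Int_absorb1 Int_absorb2 less_top[symmetric])
    show "integrable P ?s"
      using S' by (intro integrable_mult_right integrable_sum integrable_real_indicator) (auto simp: less_top[symmetric])
    show "integrable P f"
      using f by (intro integrable_const_bound[where B=1]) auto
  qed
  have "\<forall>\<^sub>F i in G. \<forall>k\<in>{..<N}. measure R (?S k) - e / 2 < measure (Q i) (?S k)"
    using e by (intro eventually_ball_finite ballI open_lim S) auto
  then show ?thesis
  proof eventually_elim
    case (elim i)
    interpret R: prob_space R by fact
    interpret Q: prob_space "Q i" by fact
    have "(\<integral>z. f z \<partial>R) \<le> (\<integral>z. ?s z \<partial>R)"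
      by (intro integral_mono ints intf R s)
    also have "\<dots> = (1 / N) * (\<Sum>k<N. measure R (?S k))" by (rule int[OF R])
    also have "\<dots> < (1 / N) * (\<Sum>k<N. measure (Q i) (?S k) + e / 2)"
      using elim N(2) by (intro mult_strict_left_mono sum_strict_mono) (force simp: field_simps)+
    also have "\<dots> = (\<integral>z. ?s z \<partial>Q i) + e / 2"
      unfolding int[OF Q] using N(2) by (simp add: sum.distrib distrib_left)
    also have "(\<integral>z. ?s z \<partial>Q i) \<le> (\<integral>z. f z + 1 / N \<partial>Q i)"
      by (intro integral_mono ints s Bochner_Integration.integrable_add intf Q) auto
    also have "\<dots> = (\<integral>z. f z \<partial>Q i) + 1 / N"
      using Q.prob_space by (subst Bochner_Integration.integral_add) (auto intro!: intf Q)
    finally show ?case using N(1) by simp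
  qed
qed

text \<open>A substitute for Prokhorov's theorem. Equal marginals provide tightness, and convergence on rectangles
  identifies the limit, so the whole net converges. Only functions with values in \<open>[0, 1]\<close> are
  treated: applying the lower bound to \<open>f\<close> and to \<open>1 - f\<close> then gives convergence.\<close>

lemma couplings_converge_weakly:
  fixes \<rho> :: "'a::polish_space measure" and Q :: "'i \<Rightarrow> ('a \<times> 'a) measure"
  assumes \<rho>: "prob_space \<rho>" "sets \<rho> = sets borel" and G: "G \<noteq> bot"
    and Q: "\<And>i. coupling \<rho> (Q i)"
    and lim: "\<And>A B. A \<in> sets borel \<Longrightarrow> B \<in> sets borel \<Longrightarrow>
       \<exists>l. ((\<lambda>i. measure (Q i) (A \<times> B)) \<longlongrightarrow> l) G"
  obtains R where "coupling \<rho> R"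
    "\<And>f. continuous_on UNIV f \<Longrightarrow> (\<And>z. 0 \<le> f z) \<Longrightarrow> (\<And>z. f z \<le> 1) \<Longrightarrow>
      ((\<lambda>i. \<integral>z. f z \<partial>Q i) \<longlongrightarrow> (\<integral>z. f z \<partial>R :: real)) G"
proof -
  define q where "q S = Lim G (\<lambda>i. measure (Q i) S)" for S
  have q: "((\<lambda>i. measure (Q i) (A \<times> B)) \<longlongrightarrow> q (A \<times> B)) G"
    if "A \<in> sets borel" "B \<in> sets borel" for A B
    using lim[OF that] tendsto_Lim[OF G] unfolding q_def by metis
  obtain R where R: "coupling \<rho> R" "\<And>A B. A\<in>sets borel \<Longrightarrow> B\<in>sets borel \<Longrightarrow> measure R (A \<times> B) = q (A \<times> B)"
    using couplings_extend[OF \<rho> G Q q] by blast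
  have Q': "prob_space (Q i)" "finite_measure (Q i)" "sets (Q i) = sets borel" for i
    using Q[of i] by (auto simp: coupling_def prob_space_def)
  have R': "prob_space R" "finite_measure R" "sets R = sets borel"
    using R by (auto simp: coupling_def prob_space_def)
  have op: "\<forall>\<^sub>F i in G. measure R S - e < measure (Q i) S" if "open S" "0 < e" for S e
    by (rule rectangle_limits_imp_open_liminf[OF Q'(2,3) R'(2,3) _ that]) (simp add: R(2) q)
  note lower = open_liminf_imp_integral_liminf[OF Q'(1,3) R'(1,3) op]
  have "((\<lambda>i. \<integral>z. f z \<partial>Q i) \<longlongrightarrow> (\<integral>z. f z \<partial>R)) G"
    if f: "continuous_on UNIV f" "\<And>z. 0 \<le> f z" "\<And>z. f z \<le> (1::real)" for f
  proof (rule tendstoI)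
    fix e :: real assume e: "0 < e"
    have compl: "(\<integral>z. 1 - f z \<partial>P) = 1 - (\<integral>z. f z \<partial>P)" if "prob_space P" "sets P = sets borel" for P
    proof -
      interpret prob_space P by fact
      have "f \<in> borel_measurable P"
        using borel_measurable_continuous_onI[OF f(1)] measurable_cong_sets[OF that(2) refl] by auto
      then have "integrable P f"
        using f by (intro integrable_const_bound[where B=1]) auto
      then show ?thesis using prob_space by (subst Bochner_Integration.integral_diff) auto
    qed
    have "\<forall>\<^sub>F i in G. (\<integral>z. f z \<partial>R) - e < (\<integral>z. f z \<partial>Q i)"
      by (rule lower) (use f e in auto)
    moreover have "\<forall>\<^sub>F i in G. (\<integral>z. 1 - f z \<partial>R) - e < (\<integral>z. 1 - f z \<partial>Q i)"
      by (rule lower) (use f e in \<open>auto intro!: continuous_intros\<close>)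
    ultimately show "\<forall>\<^sub>F i in G. dist (\<integral>z. f z \<partial>Q i) (\<integral>z. f z \<partial>R) < e"
      by eventually_elim (auto simp: compl Q' R' dist_real_def)
  qed
  with R(1) show thesis by (rule that)
qed

section \<open>The two-point motion and fresh noise\<close>

lemma abs_le_imp_square_le: "\<bar>x :: real\<bar> \<le> C \<Longrightarrow> x\<^sup>2 \<le> C\<^sup>2"
  using power_mono[of "\<bar>x\<bar>" C 2] by simp

text \<open>Replacing \<open>x\<close> by the first point of a dense sequence that is \<open>1 / (n + 1)\<close>-close to it turns \<open>f\<close> into
  a function that depends measurably on \<open>\<omega>\<close> and on a countable parameter; continuity lets \<open>n\<close> tend to
  infinity. With the noise of a finite time interval as \<open>N\<close>, this makes the cocycle jointly measurable for that noise.\<close>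

lemma Caratheodory_function_measurable:
  fixes f :: "'w \<Rightarrow> 'a::{metric_space,second_countable_topology} \<Rightarrow> 'b::metric_space"
  assumes meas: "\<And>x. (\<lambda>\<omega>. f \<omega> x) \<in> N \<rightarrow>\<^sub>M borel"
    and cont: "\<And>\<omega>. \<omega> \<in> space N \<Longrightarrow> continuous_on UNIV (f \<omega>)"
  shows "(\<lambda>(\<omega>, x). f \<omega> x) \<in> N \<Otimes>\<^sub>M borel \<rightarrow>\<^sub>M borel"
proof -
  obtain D :: "'a set" where D: "countable D" "\<And>X. open X \<Longrightarrow> X \<noteq> {} \<Longrightarrow> \<exists>d\<in>D. d \<in> X"
    by (rule countable_dense_setE) blast
  define d where "d = from_nat_into D"
  have near: "\<exists>i. dist (d i) x < e" if "0 < e" for x e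
  proof -
    have "\<exists>y\<in>D. y \<in> ball x e"
      by (rule D(2)) (use that in auto)
    then obtain y where "y \<in> D" "y \<in> ball x e" by blast
    moreover obtain i where "d i = y"
      using from_nat_into_surj[OF D(1) \<open>y \<in> D\<close>] unfolding d_def by blast
    ultimately show ?thesis
      by (intro exI[of _ i]) (simp add: dist_commute)
  qed
  define k where "k n x = (LEAST i. dist (d i) x < 1 / real (Suc n))" for n x
  have k: "dist (d (k n x)) x < 1 / real (Suc n)" for n x
    unfolding k_def by (rule LeastI_ex[OF near]) simp
  have [measurable]: "k n \<in> borel \<rightarrow>\<^sub>M count_space UNIV" for n
    unfolding k_def by measurable
  show ?thesis
  proof (rule borel_measurable_LIMSEQ_metric)
    fix n
    show "(\<lambda>(\<omega>, x). f \<omega> (d (k n x))) \<in> N \<Otimes>\<^sub>M borel \<rightarrow>\<^sub>M borel"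
      unfolding split_beta
      by (rule measurable_compose_countable[where f="\<lambda>i p. f (fst p) (d i)" and g="\<lambda>p. k n (snd p)"])
        (use meas in measurable)
  next
    fix p assume "p \<in> space (N \<Otimes>\<^sub>M (borel :: 'a measure))"
    then obtain \<omega> x where p: "p = (\<omega>, x)" "\<omega> \<in> space N" by (auto simp: space_pair_measure)
    have "(\<lambda>n. dist (d (k n x)) x) \<longlonglongrightarrow> 0"
    proof (rule tendsto_sandwich[OF _ _ tendsto_const LIMSEQ_inverse_real_of_nat])
      show "\<forall>\<^sub>F n in sequentially. dist (d (k n x)) x \<le> inverse (real (Suc n))"
        by (rule always_eventually, rule allI) (metis k less_imp_le inverse_eq_divide)
    qed simp
    then have "(\<lambda>n. d (k n x)) \<longlonglongrightarrow> x"
      by (rule iffD2[OF tendsto_dist_iff])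
    then have "(\<lambda>n. f \<omega> (d (k n x))) \<longlonglongrightarrow> f \<omega> x"
      by (rule continuous_on_tendsto_compose[OF cont[OF p(2)]]) auto
    then show "(\<lambda>n. (case p of (\<omega>, x) \<Rightarrow> f \<omega> (d (k n x)))) \<longlonglongrightarrow> (case p of (\<omega>, x) \<Rightarrow> f \<omega> x)"
      by (simp add: p)
  qed
qed

text \<open>Freezing an independent variable: if \<open>Z\<close> is independent of the randomness that enters \<open>H\<close> through its
  first argument, then the joint law is a product and Fubini's theorem applies.\<close>

lemma (in prob_space) integral_independent_substitution:
  fixes H :: "'a \<times> 'b \<Rightarrow> real"
  assumes A: "subalgebra M A" and B: "subalgebra M B"
    and indep: "\<And>a b. a \<in> sets A \<Longrightarrow> b \<in> sets B \<Longrightarrow> prob (a \<inter> b) = prob a * prob b"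
    and Z: "Z \<in> A \<rightarrow>\<^sub>M N" and H: "H \<in> borel_measurable (B \<Otimes>\<^sub>M N)" and bd: "\<And>z. \<bar>H z\<bar> \<le> C"
  shows "(\<integral>\<omega>. H (\<omega>, Z \<omega>) \<partial>M) = (\<integral>\<omega>. (\<integral>\<omega>'. H (\<omega>', Z \<omega>) \<partial>M) \<partial>M)"
proof -
  have spA: "space A = space M" "sets A \<subseteq> sets M" and spB: "space B = space M" "sets B \<subseteq> sets M"
    using A B by (auto simp: subalgebra_def)
  have idB: "(\<lambda>\<omega>. \<omega>) \<in> M \<rightarrow>\<^sub>M B"
    by (rule measurable_from_subalg[OF B]) simp
  have ZM: "Z \<in> M \<rightarrow>\<^sub>M N" by (rule measurable_from_subalg[OF A Z])
  interpret DB: prob_space "distr M B (\<lambda>\<omega>. \<omega>)" by (rule prob_space_distr[OF idB])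
  interpret DZ: prob_space "distr M N Z" by (rule prob_space_distr[OF ZM])
  interpret P: pair_prob_space "distr M B (\<lambda>\<omega>. \<omega>)" "distr M N Z" ..
  have eq: "distr M B (\<lambda>\<omega>. \<omega>) \<Otimes>\<^sub>M distr M N Z = distr M (B \<Otimes>\<^sub>M N) (\<lambda>\<omega>. (\<omega>, Z \<omega>))"
  proof (rule pair_measure_eqI)
    fix b c assume "b \<in> sets (distr M B (\<lambda>\<omega>. \<omega>))" "c \<in> sets (distr M N Z)"
    then have bc: "b \<in> sets B" "c \<in> sets N" by auto
    have "Z -` c \<inter> space M \<in> sets A" "b \<subseteq> space M" "b \<in> sets M"
      using measurable_sets[OF Z bc(2)] sets.sets_into_space[OF bc(1)] bc spA spB by auto
    moreover have "(\<lambda>\<omega>. (\<omega>, Z \<omega>)) -` (b \<times> c) \<inter> space M = (Z -` c \<inter> space M) \<inter> b"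
      "(\<lambda>\<omega>. \<omega>) -` b \<inter> space M = b"
      using \<open>b \<subseteq> space M\<close> by auto
    ultimately show "emeasure (distr M B (\<lambda>\<omega>. \<omega>)) b * emeasure (distr M N Z) c =
        emeasure (distr M (B \<Otimes>\<^sub>M N) (\<lambda>\<omega>. (\<omega>, Z \<omega>))) (b \<times> c)"
      using bc indep[of "Z -` c \<inter> space M" b]
      by (simp add: emeasure_distr idB ZM measurable_Pair emeasure_eq_measure ennreal_mult mult.commute)
  qed (auto intro: DB.sigma_finite_measure_axioms DZ.sigma_finite_measure_axioms)
  have int: "integrable (distr M B (\<lambda>\<omega>. \<omega>) \<Otimes>\<^sub>M distr M N Z) H"
    using H bd by (intro P.integrable_const_bound[where B=C]) (auto cong: measurable_cong_sets)
  have H1: "(\<lambda>\<omega>. H (\<omega>, z)) \<in> borel_measurable B" if "z \<in> space N" for z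
    using H that by measurable
  have H2: "(\<lambda>z. \<integral>\<omega>. H (\<omega>, z) \<partial>distr M B (\<lambda>\<omega>. \<omega>)) \<in> borel_measurable N"
  proof -
    have "(\<lambda>(z, \<omega>). H (\<omega>, z)) \<in> borel_measurable (N \<Otimes>\<^sub>M distr M B (\<lambda>\<omega>. \<omega>))"
      using H by measurable
    then show ?thesis by (rule DB.borel_measurable_lebesgue_integral)
  qed
  have "(\<integral>\<omega>. H (\<omega>, Z \<omega>) \<partial>M) = integral\<^sup>L (distr M (B \<Otimes>\<^sub>M N) (\<lambda>\<omega>. (\<omega>, Z \<omega>))) H"
    by (rule integral_distr[symmetric, OF measurable_Pair[OF idB ZM] H])
  also have "\<dots> = (\<integral>z. (\<integral>\<omega>. H (\<omega>, z) \<partial>distr M B (\<lambda>\<omega>. \<omega>)) \<partial>distr M N Z)"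
    unfolding eq[symmetric] using P.integral_snd[of "\<lambda>\<omega> z. H (\<omega>, z)"] int by simp
  also have "\<dots> = (\<integral>\<omega>. (\<integral>\<omega>'. H (\<omega>', Z \<omega>) \<partial>distr M B (\<lambda>\<omega>. \<omega>)) \<partial>M)"
    by (rule integral_distr[OF ZM H2])
  also have "\<dots> = (\<integral>\<omega>. (\<integral>\<omega>'. H (\<omega>', Z \<omega>) \<partial>M) \<partial>M)"
    using measurable_space[OF ZM] by (intro Bochner_Integration.integral_cong refl integral_distr[OF idB] H1) auto
  finally show ?thesis .
qed

definition two_point_semigroup ::
    "'w measure \<Rightarrow> (real \<Rightarrow> 'w \<Rightarrow> 'e \<Rightarrow> 'e) \<Rightarrow> real \<Rightarrow> ('e \<times> 'e \<Rightarrow> real) \<Rightarrow> 'e \<times> 'e \<Rightarrow> real" where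
  "two_point_semigroup M \<phi> t G z = (\<integral>\<omega>. G (\<phi> t \<omega> (fst z), \<phi> t \<omega> (snd z)) \<partial>M)"

context white_noise_rds
begin

abbreviation P2 :: "real \<Rightarrow> ('e \<times> 'e \<Rightarrow> real) \<Rightarrow> 'e \<times> 'e \<Rightarrow> real" where
  "P2 \<equiv> two_point_semigroup M \<phi>"

lemma flow_measurable_at [measurable]: "\<theta> t \<in> M \<rightarrow>\<^sub>M M"
proof -
  have "(\<lambda>\<omega>. (t, \<omega>)) \<in> M \<rightarrow>\<^sub>M borel \<Otimes>\<^sub>M M" by simp
  from measurable_compose[OF this flow_measurable] show ?thesis by simp
qed

lemma integral_flow:
  fixes f :: "'w \<Rightarrow> real"
  assumes "f \<in> borel_measurable M"
  shows "(\<integral>\<omega>. f (\<theta> t \<omega>) \<partial>M) = (\<integral>\<omega>. f \<omega> \<partial>M)"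
  using integral_distr[OF flow_measurable_at[of t] assms] by (simp add: flow_invariant)

lemma flow_noise_measurable:
  assumes "s \<le> t"
  shows "\<theta> r \<in> F (s + r) (t + r) \<rightarrow>\<^sub>M F s t"
proof (rule measurableI)
  have sp: "space (F s t) = space M" "space (F (s + r) (t + r)) = space M"
    using assms noise_subalgebra[of s t] noise_subalgebra[of "s + r" "t + r"] by (auto simp: subalgebra_def)
  show "\<theta> r \<omega> \<in> space (F s t)" if "\<omega> \<in> space (F (s + r) (t + r))" for \<omega>
    using measurable_space[OF flow_measurable_at[of r]] that sp by auto
  show "\<theta> r -` A \<inter> space (F (s + r) (t + r)) \<in> sets (F (s + r) (t + r))" if "A \<in> sets (F s t)" for A
    using noise_shift[OF assms, of r] that sp by auto
qed

lemma cocycle_joint_noise_measurable: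
  assumes "0 \<le> t"
  shows "(\<lambda>(\<omega>, x). \<phi> t \<omega> x) \<in> F 0 t \<Otimes>\<^sub>M borel \<rightarrow>\<^sub>M borel"
  using noise_subalgebra[OF assms] assms
  by (intro Caratheodory_function_measurable cocycle_noise_measurable cocycle_continuous)
    (auto simp: subalgebra_def)

lemma cocycle_joint_measurable:
  assumes "0 \<le> t"
  shows "(\<lambda>(\<omega>, x). \<phi> t \<omega> x) \<in> M \<Otimes>\<^sub>M borel \<rightarrow>\<^sub>M borel"
  using assms measurable_from_subalg[OF noise_subalgebra[OF assms] cocycle_noise_measurable]
  by (intro Caratheodory_function_measurable cocycle_continuous) auto

lemma cocycle_measurable_compose [measurable (raw)]:
  assumes "0 \<le> t" "f \<in> N \<rightarrow>\<^sub>M M" "g \<in> N \<rightarrow>\<^sub>M borel"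
  shows "(\<lambda>x. \<phi> t (f x) (g x)) \<in> N \<rightarrow>\<^sub>M borel"
  using measurable_compose[OF measurable_Pair[OF assms(2,3)] cocycle_joint_measurable[OF assms(1)]] by simp

lemma noise_prob_Int:
  assumes "s \<le> t" "t \<le> u" "a \<in> sets (F s t)" "b \<in> sets (F t u)"
  shows "prob (a \<inter> b) = prob a * prob b"
proof -
  let ?t = "\<lambda>i::nat. if i = 0 then s else if i = 1 then t else u"
  have "indep_sets (\<lambda>i. sets (F (?t i) (?t (Suc i)))) {..<2}"
    by (rule noise_indep) (use assms in auto)
  from indep_setsD[OF this, of "{0, 1}" "\<lambda>i. if i = 0 then a else b"]
  show ?thesis using assms by (simp add: Int_commute mult.commute)
qed

text \<open>The Markov property in the form needed below: after time \<open>s\<close> the flow uses noise from \<open>F s (s + t)\<close>,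
  which is independent of everything in \<open>F 0 s\<close>, in particular of the pair \<open>Z\<close> of points that it moves.
  Allowing arbitrary \<open>Z\<close> covers both a pair of trajectories and a trajectory paired with a fixed point.\<close>

lemma fresh_noise:
  assumes st: "0 \<le> s" "0 \<le> t" and Z: "Z \<in> F 0 s \<rightarrow>\<^sub>M borel"
    and G: "G \<in> borel_measurable borel" and bd: "\<And>z. \<bar>G z\<bar> \<le> C"
  shows "(\<integral>\<omega>. G (\<phi> t (\<theta> s \<omega>) (fst (Z \<omega>)), \<phi> t (\<theta> s \<omega>) (snd (Z \<omega>))) \<partial>M) = (\<integral>\<omega>. P2 t G (Z \<omega>) \<partial>M)"
proof -
  define H where "H p = G (\<phi> t (\<theta> s (fst p)) (fst (snd p)), \<phi> t (\<theta> s (fst p)) (snd (snd p)))" for p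
  have [measurable]: "\<theta> s \<in> F s (s + t) \<rightarrow>\<^sub>M F 0 t"
    using flow_noise_measurable[of 0 t s] st by (simp add: add.commute)
  have c[measurable (raw)]: "(\<lambda>x. \<phi> t (f x) (g x)) \<in> N \<rightarrow>\<^sub>M borel"
    if "f \<in> N \<rightarrow>\<^sub>M F 0 t" "g \<in> N \<rightarrow>\<^sub>M borel" for f g and N :: "('w \<times> 'e \<times> 'e) measure"
    using measurable_compose[OF measurable_Pair[OF that] cocycle_joint_noise_measurable[OF st(2)]] by simp
  have H: "H \<in> borel_measurable (F s (s + t) \<Otimes>\<^sub>M borel)"
    unfolding H_def borel_prod[symmetric]
    by (rule measurable_compose[OF _ G[unfolded borel_prod[symmetric]]]) measurable
  have "(\<integral>\<omega>. H (\<omega>, Z \<omega>) \<partial>M) = (\<integral>\<omega>. (\<integral>\<omega>'. H (\<omega>', Z \<omega>) \<partial>M) \<partial>M)"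
  proof (rule integral_independent_substitution[OF _ _ _ Z H])
    show "subalgebra M (F 0 s)" "subalgebra M (F s (s + t))"
      using st by (auto intro: noise_subalgebra)
    show "prob (a \<inter> b) = prob a * prob b" if "a \<in> sets (F 0 s)" "b \<in> sets (F s (s + t))" for a b
      using noise_prob_Int[of 0 s "s + t"] that st by simp
    show "\<bar>H z\<bar> \<le> C" for z using bd by (simp add: H_def)
  qed
  moreover have "(\<integral>\<omega>'. H (\<omega>', z) \<partial>M) = P2 t G z" for z
  proof -
    have [measurable]: "G \<in> borel_measurable (borel \<Otimes>\<^sub>M borel)" using G by (simp add: borel_prod)
    have "(\<lambda>\<omega>. G (\<phi> t \<omega> (fst z), \<phi> t \<omega> (snd z))) \<in> borel_measurable M"
      using st by measurable
    from integral_flow[OF this, of s] show ?thesis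
      by (simp add: H_def two_point_semigroup_def)
  qed
  ultimately show ?thesis by (simp add: H_def)
qed

lemma two_point_semigroup_add:
  assumes "0 \<le> s" "0 \<le> t" and G: "G \<in> borel_measurable borel" and bd: "\<And>z. \<bar>G z\<bar> \<le> C"
  shows "P2 (s + t) G z = P2 s (P2 t G) z"
proof -
  let ?Z = "\<lambda>\<omega>. (\<phi> s \<omega> (fst z), \<phi> s \<omega> (snd z))"
  have "?Z \<in> F 0 s \<rightarrow>\<^sub>M borel"
    unfolding borel_prod[symmetric] by (intro measurable_Pair cocycle_noise_measurable assms)
  from fresh_noise[OF assms(1,2) this G bd]
  have "(\<integral>\<omega>. P2 t G (?Z \<omega>) \<partial>M) = (\<integral>\<omega>. G (\<phi> t (\<theta> s \<omega>) (\<phi> s \<omega> (fst z)), \<phi> t (\<theta> s \<omega>) (\<phi> s \<omega> (snd z))) \<partial>M)"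
    by simp
  also have "\<dots> = P2 (s + t) G z"
    unfolding two_point_semigroup_def using assms
    by (intro Bochner_Integration.integral_cong) (auto simp: cocycle_add add.commute[of s])
  finally show ?thesis by (simp add: two_point_semigroup_def)
qed

lemma two_point_measurable [measurable (raw)]:
  assumes "0 \<le> t" "G \<in> borel_measurable borel" "f \<in> N \<rightarrow>\<^sub>M M" "g \<in> N \<rightarrow>\<^sub>M borel" "h \<in> N \<rightarrow>\<^sub>M borel"
  shows "(\<lambda>x. G (\<phi> t (f x) (g x), \<phi> t (f x) (h x))) \<in> borel_measurable N"
proof -
  have "(\<lambda>x. (\<phi> t (f x) (g x), \<phi> t (f x) (h x))) \<in> N \<rightarrow>\<^sub>M borel"
    unfolding borel_prod[symmetric] using assms by measurable
  from measurable_compose[OF this assms(2)] show ?thesis .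
qed

lemma two_point_integrable:
  assumes "0 \<le> t" "G \<in> borel_measurable borel" "\<And>z. \<bar>G z\<bar> \<le> (C::real)"
  shows "integrable M (\<lambda>\<omega>. G (\<phi> t \<omega> x, \<phi> t \<omega> y))"
  using assms by (intro integrable_const_bound[where B=C]) auto

lemma two_point_semigroup_abs_le:
  assumes "0 \<le> t" "G \<in> borel_measurable borel" "\<And>z. \<bar>G z\<bar> \<le> (C::real)"
  shows "\<bar>P2 t G z\<bar> \<le> C"
proof -
  have "\<bar>P2 t G z\<bar> \<le> (\<integral>\<omega>. \<bar>G (\<phi> t \<omega> (fst z), \<phi> t \<omega> (snd z))\<bar> \<partial>M)"
    unfolding two_point_semigroup_def by (rule integral_abs_bound)
  also have "\<dots> \<le> C"
    using assms by (intro integral_le_const integrable_abs two_point_integrable[of t G C]) auto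
  finally show ?thesis .
qed

lemma two_point_semigroup_measurable:
  assumes "0 \<le> t" and G: "G \<in> borel_measurable borel"
  shows "P2 t G \<in> borel_measurable borel"
proof -
  have "(\<lambda>(z, \<omega>). G (\<phi> t \<omega> (fst z), \<phi> t \<omega> (snd z))) \<in> borel_measurable ((borel \<Otimes>\<^sub>M borel) \<Otimes>\<^sub>M M)"
    using assms by measurable
  then have "(\<lambda>z. \<integral>\<omega>. G (\<phi> t \<omega> (fst z), \<phi> t \<omega> (snd z)) \<partial>M) \<in> borel_measurable (borel \<Otimes>\<^sub>M borel)"
    by (rule borel_measurable_lebesgue_integral)
  then show ?thesis
    by (simp add: two_point_semigroup_def[abs_def] borel_prod)
qed

lemma two_point_semigroup_continuous:
  assumes t: "0 \<le> t" and G: "continuous_on UNIV G" and bd: "\<And>z. \<bar>G z\<bar> \<le> C"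
  shows "continuous_on UNIV (P2 t G)"
  unfolding continuous_on_sequentially
proof (intro allI ballI impI, elim conjE)
  fix z :: "nat \<Rightarrow> 'e \<times> 'e" and a assume z: "z \<longlonglongrightarrow> a"
  have [measurable]: "G \<in> borel_measurable borel"
    using G by (rule borel_measurable_continuous_onI)
  show "(P2 t G \<circ> z) \<longlonglongrightarrow> P2 t G a"
    unfolding two_point_semigroup_def comp_def
  proof (rule integral_dominated_convergence[where w="\<lambda>_. C"])
    show "AE \<omega> in M. (\<lambda>n. G (\<phi> t \<omega> (fst (z n)), \<phi> t \<omega> (snd (z n)))) \<longlonglongrightarrow> G (\<phi> t \<omega> (fst a), \<phi> t \<omega> (snd a))"
    proof (rule AE_I2)
      fix \<omega> assume \<omega>: "\<omega> \<in> space M"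
      show "(\<lambda>n. G (\<phi> t \<omega> (fst (z n)), \<phi> t \<omega> (snd (z n)))) \<longlonglongrightarrow> G (\<phi> t \<omega> (fst a), \<phi> t \<omega> (snd a))"
        by (rule continuous_on_tendsto_compose[OF G] continuous_on_tendsto_compose[OF cocycle_continuous[OF t \<omega>]]
            tendsto_Pair tendsto_fst[OF z] tendsto_snd[OF z] | simp)+
    qed
  qed (use t bd in auto)
qed

end

section \<open>The two-point motion started from independent stationary points\<close>

locale stationary_rds = white_noise_rds M \<theta> \<phi> F
  for M :: "'w measure" and \<theta> and \<phi> :: "real \<Rightarrow> 'w \<Rightarrow> 'e::polish_space \<Rightarrow> 'e" and F +
  fixes \<rho> :: "'e measure"
  assumes invariant: "invariant_prob M \<phi> \<rho>"

sublocale stationary_rds \<subseteq> \<rho>: prob_space \<rho>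
  using invariant by (simp add: invariant_prob_def)

sublocale stationary_rds \<subseteq> \<rho>\<rho>: pair_prob_space \<rho> \<rho> ..

context stationary_rds
begin

lemma sets_rho [simp, measurable_cong]: "sets \<rho> = sets borel"
  using invariant by (simp add: invariant_prob_def)

lemma space_rho [simp]: "space \<rho> = UNIV"
  using sets_eq_imp_space_eq[OF sets_rho] by simp

lemma integral_rho_invariant:
  assumes t: "0 \<le> t" and [measurable]: "f \<in> borel_measurable borel" and bd: "\<And>x. \<bar>f x\<bar> \<le> (C::real)"
  shows "(\<integral>\<omega>. (\<integral>x. f (\<phi> t \<omega> x) \<partial>\<rho>) \<partial>M) = (\<integral>x. f x \<partial>\<rho>)"
proof -
  interpret P: pair_prob_space M \<rho> ..
  have "integrable (M \<Otimes>\<^sub>M \<rho>) (\<lambda>(\<omega>, x). f (\<phi> t \<omega> x))"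
    using t bd by (intro P.integrable_const_bound[where B=C]) auto
  from P.Fubini_integral[OF this]
  have "(\<integral>\<omega>. (\<integral>x. f (\<phi> t \<omega> x) \<partial>\<rho>) \<partial>M) = (\<integral>x. markov_semigroup M \<phi> t f x \<partial>\<rho>)"
    by (simp add: markov_semigroup_def)
  also have "\<dots> = (\<integral>x. f x \<partial>\<rho>)"
  proof -
    have "bounded (range f)" using bd by (auto simp: bounded_iff)
    with invariant t show ?thesis by (simp add: invariant_prob_def)
  qed
  finally show ?thesis .
qed

text \<open>The law at time \<open>t\<close> of two points that start independently with law \<open>\<rho>\<close> and move with the same noise.
  The cocycle is controlled for \<open>t \<ge> 0\<close> only; where a family indexed by all real times is convenient,
  \<open>max 0 t\<close> appears instead of \<open>t\<close>.\<close>

definition two_point_law :: "real \<Rightarrow> ('e \<times> 'e) measure" where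
  "two_point_law t = distr (M \<Otimes>\<^sub>M (\<rho> \<Otimes>\<^sub>M \<rho>)) borel (\<lambda>(\<omega>, z). (\<phi> t \<omega> (fst z), \<phi> t \<omega> (snd z)))"

lemma two_point_map_measurable:
  assumes "0 \<le> t"
  shows "(\<lambda>(\<omega>, z). (\<phi> t \<omega> (fst z), \<phi> t \<omega> (snd z))) \<in> M \<Otimes>\<^sub>M (\<rho> \<Otimes>\<^sub>M \<rho>) \<rightarrow>\<^sub>M borel"
  using assms unfolding borel_prod[symmetric] by measurable

lemma sets_two_point_law [simp, measurable_cong]: "sets (two_point_law t) = sets borel"
  by (simp add: two_point_law_def)

lemma prob_space_two_point_law: "0 \<le> t \<Longrightarrow> prob_space (two_point_law t)"
proof -
  assume t: "0 \<le> t"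
  interpret P: pair_prob_space M "\<rho> \<Otimes>\<^sub>M \<rho>" ..
  show ?thesis
    unfolding two_point_law_def by (rule P.prob_space_distr[OF two_point_map_measurable[OF t]])
qed

lemma integral_two_point_law:
  assumes t: "0 \<le> t" and G: "G \<in> borel_measurable borel" and bd: "\<And>z. \<bar>G z\<bar> \<le> (C::real)"
  shows "(\<integral>z. G z \<partial>two_point_law t) = (\<integral>\<omega>. (\<integral>z. G (\<phi> t \<omega> (fst z), \<phi> t \<omega> (snd z)) \<partial>(\<rho> \<Otimes>\<^sub>M \<rho>)) \<partial>M)"
    and "(\<integral>z. G z \<partial>two_point_law t) = (\<integral>z. P2 t G z \<partial>(\<rho> \<Otimes>\<^sub>M \<rho>))"
proof -
  interpret P: pair_prob_space M "\<rho> \<Otimes>\<^sub>M \<rho>" ..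
  note [measurable] = G
  have *: "(\<integral>z. G z \<partial>two_point_law t) =
      (\<integral>(\<omega>, z). G (\<phi> t \<omega> (fst z), \<phi> t \<omega> (snd z)) \<partial>(M \<Otimes>\<^sub>M (\<rho> \<Otimes>\<^sub>M \<rho>)))"
    unfolding two_point_law_def by (subst integral_distr[OF two_point_map_measurable[OF t] G]) (simp add: split_beta')
  have int: "integrable (M \<Otimes>\<^sub>M (\<rho> \<Otimes>\<^sub>M \<rho>)) (\<lambda>(\<omega>, z). G (\<phi> t \<omega> (fst z), \<phi> t \<omega> (snd z)))"
    using t bd by (intro P.integrable_const_bound[where B=C]) (auto simp: split_beta)
  show "(\<integral>z. G z \<partial>two_point_law t) = (\<integral>\<omega>. (\<integral>z. G (\<phi> t \<omega> (fst z), \<phi> t \<omega> (snd z)) \<partial>(\<rho> \<Otimes>\<^sub>M \<rho>)) \<partial>M)"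
    unfolding * by (rule P.integral_fst[OF int, symmetric])
  show "(\<integral>z. G z \<partial>two_point_law t) = (\<integral>z. P2 t G z \<partial>(\<rho> \<Otimes>\<^sub>M \<rho>))"
    unfolding * two_point_semigroup_def by (rule P.integral_snd[OF int, symmetric])
qed

lemma integral_two_point_law_add:
  assumes "0 \<le> s" "0 \<le> t" and G: "G \<in> borel_measurable borel" and bd: "\<And>z. \<bar>G z\<bar> \<le> (C::real)"
  shows "(\<integral>z. G z \<partial>two_point_law (s + t)) = (\<integral>z. P2 t G z \<partial>two_point_law s)"
proof -
  have "(\<integral>z. P2 t G z \<partial>two_point_law s) = (\<integral>z. P2 s (P2 t G) z \<partial>(\<rho> \<Otimes>\<^sub>M \<rho>))"
    by (rule integral_two_point_law(2)[where C=C])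
      (use assms in \<open>auto intro: two_point_semigroup_measurable two_point_semigroup_abs_le\<close>)
  also have "\<dots> = (\<integral>z. P2 (s + t) G z \<partial>(\<rho> \<Otimes>\<^sub>M \<rho>))"
    using two_point_semigroup_add[OF assms] by simp
  also have "\<dots> = (\<integral>z. G z \<partial>two_point_law (s + t))"
    by (rule integral_two_point_law(2)[where C=C, symmetric]) (use assms in auto)
  finally show ?thesis by simp
qed

lemma integral_product_rho:
  assumes [measurable]: "f \<in> borel_measurable borel" "g \<in> borel_measurable borel"
    and bd: "\<And>x. \<bar>f x\<bar> \<le> (C::real)" "\<And>x. \<bar>g x\<bar> \<le> D"
  shows "(\<integral>z. f (fst z) * g (snd z) \<partial>(\<rho> \<Otimes>\<^sub>M \<rho>)) = (\<integral>x. f x \<partial>\<rho>) * (\<integral>x. g x \<partial>\<rho>)"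
proof -
  have int: "integrable (\<rho> \<Otimes>\<^sub>M \<rho>) (\<lambda>z. f (fst z) * g (snd z))"
  proof (intro \<rho>\<rho>.integrable_const_bound[where B="C * D"] AE_I2)
    fix z show "norm (f (fst z) * g (snd z)) \<le> C * D"
      using bd(1)[of "fst z"] bd(2)[of "snd z"] by (auto simp: abs_mult intro!: mult_mono)
  qed measurable
  have "(\<integral>z. f (fst z) * g (snd z) \<partial>(\<rho> \<Otimes>\<^sub>M \<rho>)) = (\<integral>x. (\<integral>y. f x * g y \<partial>\<rho>) \<partial>\<rho>)"
    using \<rho>\<rho>.integral_fst'[OF int] by simp
  then show ?thesis by simp
qed

text \<open>Given the noise, the two points are independent, each with the random law \<open>\<mu> \<omega>\<close> obtained by transporting
  \<open>\<rho>\<close> with \<open>\<phi> t \<omega>\<close>. Hence the law of the pair is the mean of \<open>\<mu> \<omega> \<times> \<mu> \<omega>\<close>.\<close>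

lemma integral_two_point_law_product:
  assumes t: "0 \<le> t" and [measurable]: "f \<in> borel_measurable borel" "g \<in> borel_measurable borel"
    and bd: "\<And>x. \<bar>f x\<bar> \<le> (C::real)" "\<And>x. \<bar>g x\<bar> \<le> D"
  shows "(\<integral>z. f (fst z) * g (snd z) \<partial>two_point_law t) =
    (\<integral>\<omega>. (\<integral>x. f (\<phi> t \<omega> x) \<partial>\<rho>) * (\<integral>x. g (\<phi> t \<omega> x) \<partial>\<rho>) \<partial>M)"
proof -
  have "(\<integral>z. f (fst z) * g (snd z) \<partial>two_point_law t) =
    (\<integral>\<omega>. (\<integral>z. f (\<phi> t \<omega> (fst z)) * g (\<phi> t \<omega> (snd z)) \<partial>(\<rho> \<Otimes>\<^sub>M \<rho>)) \<partial>M)"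
  proof (subst integral_two_point_law(1)[OF t, where C="C * D"])
    show "(\<lambda>z. f (fst z) * g (snd z)) \<in> borel_measurable borel"
      unfolding borel_prod[symmetric] by measurable
    show "\<bar>f (fst z) * g (snd z)\<bar> \<le> C * D" for z
      using bd(1)[of "fst z"] bd(2)[of "snd z"] by (auto simp: abs_mult intro!: mult_mono)
  qed simp
  also have "\<dots> = (\<integral>\<omega>. (\<integral>x. f (\<phi> t \<omega> x) \<partial>\<rho>) * (\<integral>x. g (\<phi> t \<omega> x) \<partial>\<rho>) \<partial>M)"
  proof (intro Bochner_Integration.integral_cong refl)
    fix \<omega> assume \<omega>: "\<omega> \<in> space M"
    have [measurable]: "\<phi> t \<omega> \<in> borel \<rightarrow>\<^sub>M borel"
      by (rule borel_measurable_continuous_onI[OF cocycle_continuous[OF t \<omega>]])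
    show "(\<integral>z. f (\<phi> t \<omega> (fst z)) * g (\<phi> t \<omega> (snd z)) \<partial>(\<rho> \<Otimes>\<^sub>M \<rho>)) =
      (\<integral>x. f (\<phi> t \<omega> x) \<partial>\<rho>) * (\<integral>x. g (\<phi> t \<omega> x) \<partial>\<rho>)"
      by (rule integral_product_rho[where C=C and D=D]) (use bd in auto)
  qed
  finally show ?thesis .
qed

lemma random_measure_bound:
  assumes t: "0 \<le> t" and [measurable]: "f \<in> borel_measurable borel" and bd: "\<And>x. \<bar>f x\<bar> \<le> (C::real)"
  shows "(\<lambda>\<omega>. \<integral>x. f (\<phi> t \<omega> x) \<partial>\<rho>) \<in> borel_measurable M"
    and "\<omega> \<in> space M \<Longrightarrow> \<bar>\<integral>x. f (\<phi> t \<omega> x) \<partial>\<rho>\<bar> \<le> C"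
    and "\<omega> \<in> space M \<Longrightarrow> integrable \<rho> (\<lambda>x. f (\<phi> t \<omega> x))"
proof -
  show "(\<lambda>\<omega>. \<integral>x. f (\<phi> t \<omega> x) \<partial>\<rho>) \<in> borel_measurable M"
    using t by measurable
  assume \<omega>: "\<omega> \<in> space M"
  have [measurable]: "\<phi> t \<omega> \<in> borel \<rightarrow>\<^sub>M borel"
    by (rule borel_measurable_continuous_onI[OF cocycle_continuous[OF t \<omega>]])
  show int: "integrable \<rho> (\<lambda>x. f (\<phi> t \<omega> x))"
    using bd by (intro \<rho>.integrable_const_bound[where B=C]) auto
  have "\<bar>\<integral>x. f (\<phi> t \<omega> x) \<partial>\<rho>\<bar> \<le> (\<integral>x. \<bar>f (\<phi> t \<omega> x)\<bar> \<partial>\<rho>)" by (rule integral_abs_bound)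
  also have "\<dots> \<le> C" using bd int by (intro \<rho>.integral_le_const integrable_abs) auto
  finally show "\<bar>\<integral>x. f (\<phi> t \<omega> x) \<partial>\<rho>\<bar> \<le> C" .
qed

lemma two_point_law_rectangle:
  assumes t: "0 \<le> t" and A: "A \<in> sets borel" and B: "B \<in> sets borel"
  shows "measure (two_point_law t) (A \<times> B) =
    (\<integral>\<omega>. (\<integral>x. indicator A (\<phi> t \<omega> x) \<partial>\<rho>) * (\<integral>x. indicator B (\<phi> t \<omega> x) \<partial>\<rho>) \<partial>M)"
proof -
  have "measure (two_point_law t) (A \<times> B) = (\<integral>z. indicator (A \<times> B) z \<partial>two_point_law t)"
    using sets_eq_imp_space_eq[OF sets_two_point_law[of t]] by simp
  also have "\<dots> = (\<integral>z. indicator A (fst z) * indicator B (snd z) \<partial>two_point_law t)"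
    by (intro Bochner_Integration.integral_cong refl) (auto split: split_indicator)
  also have "\<dots> = (\<integral>\<omega>. (\<integral>x. indicator A (\<phi> t \<omega> x) \<partial>\<rho>) * (\<integral>x. indicator B (\<phi> t \<omega> x) \<partial>\<rho>) \<partial>M)"
    by (rule integral_two_point_law_product[OF t, where C=1 and D=1]) (use A B in auto)
  finally show ?thesis .
qed

lemma two_point_law_coupling:
  assumes t: "0 \<le> t"
  shows "coupling \<rho> (two_point_law t)"
proof -
  have "(\<integral>\<omega>. (\<integral>x. indicator A (\<phi> t \<omega> x) \<partial>\<rho>) \<partial>M) = measure \<rho> A" if "A \<in> sets borel" for A
    using integral_rho_invariant[OF t, of "indicator A" 1] that by simp
  then show ?thesis
    using t by (auto simp: coupling_def prob_space_two_point_law two_point_law_rectangle \<rho>.prob_space[simplified])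
qed

text \<open>Jensen's inequality: the right-hand side is the second moment of the random integral of \<open>h\<close> against the
  transported measure, and by invariance the mean of this random integral is the integral of \<open>h\<close> with respect to \<open>\<rho>\<close>.\<close>

lemma integral_product_two_point_law_ge:
  assumes s: "0 \<le> s" and h: "h \<in> borel_measurable borel" and bd: "\<And>x. \<bar>h x\<bar> \<le> (C::real)"
  shows "(\<integral>x. h x \<partial>\<rho>)\<^sup>2 \<le> (\<integral>z. h (fst z) * h (snd z) \<partial>two_point_law s)"
proof -
  define X where "X \<omega> = (\<integral>x. h (\<phi> s \<omega> x) \<partial>\<rho>)" for \<omega>
  have X: "X \<in> borel_measurable M" "\<And>\<omega>. \<omega> \<in> space M \<Longrightarrow> \<bar>X \<omega>\<bar> \<le> C"
    unfolding X_def using random_measure_bound[OF s h bd] by auto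
  have "0 \<le> C" using bd[of undefined] by simp
  have iX: "integrable M X" using X by (intro integrable_const_bound[where B=C]) auto
  have iX2: "integrable M (\<lambda>\<omega>. (X \<omega>)\<^sup>2)"
    using X \<open>0 \<le> C\<close> by (intro integrable_const_bound[where B="C\<^sup>2"]) (auto intro!: AE_I2 abs_le_imp_square_le)
  have "(\<integral>x. h x \<partial>\<rho>) = expectation X"
    unfolding X_def by (rule integral_rho_invariant[OF s h bd, symmetric])
  moreover have "(\<integral>z. h (fst z) * h (snd z) \<partial>two_point_law s) = expectation (\<lambda>\<omega>. (X \<omega>)\<^sup>2)"
    unfolding X_def power2_eq_square by (rule integral_two_point_law_product[OF s h h bd bd])
  ultimately show ?thesis
    using variance_positive[of X] variance_eq[OF iX iX2] by simp
qed

text \<open>This is the place where the martingale property of the transported measures enters. Splitting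
  \<open>[0, s + t]\<close> at time \<open>s\<close> and freezing the later noise, the inner expectation is the second moment
  at time \<open>s\<close> of \<open>h = f \<circ> \<phi> t \<omega>\<close>, which Jensen's inequality bounds from below.\<close>

lemma second_moment_mono:
  assumes st: "0 \<le> s" "0 \<le> t" and f[measurable]: "f \<in> borel_measurable borel" and bd: "\<And>x. \<bar>f x\<bar> \<le> (C::real)"
  shows "(\<integral>z. f (fst z) * f (snd z) \<partial>two_point_law t) \<le> (\<integral>z. f (fst z) * f (snd z) \<partial>two_point_law (s + t))"
proof -
  interpret Q: prob_space "two_point_law s" by (rule prob_space_two_point_law[OF st(1)])
  interpret P: pair_prob_space "two_point_law s" M ..
  let ?G = "\<lambda>z. f (fst z) * f (snd z)"
  have G: "?G \<in> borel_measurable borel"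
    unfolding borel_prod[symmetric] by measurable
  have Gbd: "\<bar>?G z\<bar> \<le> C * C" for z
    using bd[of "fst z"] bd[of "snd z"] by (auto simp: abs_mult intro!: mult_mono)
  have int: "integrable (two_point_law s \<Otimes>\<^sub>M M) (\<lambda>(z, \<omega>). ?G (\<phi> t \<omega> (fst z), \<phi> t \<omega> (snd z)))"
  proof (intro P.integrable_const_bound[where B="C * C"])
    show "(\<lambda>(z, \<omega>). ?G (\<phi> t \<omega> (fst z), \<phi> t \<omega> (snd z))) \<in> borel_measurable (two_point_law s \<Otimes>\<^sub>M M)"
      unfolding measurable_cong_sets[OF sets_pair_measure_cong[OF sets_two_point_law refl] refl] borel_prod[symmetric]
      using st by measurable
  qed (use Gbd in \<open>auto simp: split_beta\<close>)
  have "(\<integral>z. ?G z \<partial>two_point_law t) = (\<integral>\<omega>. (\<integral>x. f (\<phi> t \<omega> x) \<partial>\<rho>)\<^sup>2 \<partial>M)"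
    unfolding power2_eq_square by (rule integral_two_point_law_product[OF st(2) f f bd bd])
  also have "\<dots> \<le> (\<integral>\<omega>. (\<integral>z. ?G (\<phi> t \<omega> (fst z), \<phi> t \<omega> (snd z)) \<partial>two_point_law s) \<partial>M)"
  proof (rule integral_mono)
    show "integrable M (\<lambda>\<omega>. (\<integral>x. f (\<phi> t \<omega> x) \<partial>\<rho>)\<^sup>2)"
      using random_measure_bound[OF st(2) f bd] order_trans[OF abs_ge_zero bd]
      by (intro integrable_const_bound[where B="C\<^sup>2"]) (auto intro!: AE_I2 abs_le_imp_square_le)
    show "integrable M (\<lambda>\<omega>. \<integral>z. ?G (\<phi> t \<omega> (fst z), \<phi> t \<omega> (snd z)) \<partial>two_point_law s)"
      by (rule P.integrable_snd[OF int])
    fix \<omega> assume \<omega>: "\<omega> \<in> space M"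
    have [measurable]: "\<phi> t \<omega> \<in> borel \<rightarrow>\<^sub>M borel"
      by (rule borel_measurable_continuous_onI[OF cocycle_continuous[OF st(2) \<omega>]])
    show "(\<integral>x. f (\<phi> t \<omega> x) \<partial>\<rho>)\<^sup>2 \<le> (\<integral>z. ?G (\<phi> t \<omega> (fst z), \<phi> t \<omega> (snd z)) \<partial>two_point_law s)"
      using integral_product_two_point_law_ge[OF st(1), of "\<lambda>x. f (\<phi> t \<omega> x)" C] bd by simp
  qed
  also have "\<dots> = (\<integral>z. P2 t ?G z \<partial>two_point_law s)"
    unfolding two_point_semigroup_def by (rule P.Fubini_integral[OF int])
  also have "\<dots> = (\<integral>z. ?G z \<partial>two_point_law (s + t))"
    by (rule integral_two_point_law_add[OF st G Gbd, symmetric])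
  finally show ?thesis .
qed

lemma second_moment_converges:
  assumes f[measurable]: "f \<in> borel_measurable borel" and bd: "\<And>x. \<bar>f x\<bar> \<le> (C::real)"
  shows "\<exists>l. ((\<lambda>t. \<integral>\<omega>. (\<integral>x. f (\<phi> (max 0 t) \<omega> x) \<partial>\<rho>)\<^sup>2 \<partial>M) \<longlongrightarrow> l) at_top"
proof -
  define m where "m t = (\<integral>\<omega>. (\<integral>x. f (\<phi> (max 0 t) \<omega> x) \<partial>\<rho>)\<^sup>2 \<partial>M)" for t
  have m_eq: "m t = (\<integral>z. f (fst z) * f (snd z) \<partial>two_point_law (max 0 t))" for t
    unfolding m_def power2_eq_square by (rule integral_two_point_law_product[OF _ f f bd bd, symmetric]) simp
  have "mono m"
  proof (rule monoI)
    fix s t :: real assume "s \<le> t"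
    then show "m s \<le> m t"
      unfolding m_eq using second_moment_mono[of "max 0 t - max 0 s" "max 0 s" f C, OF _ _ f bd] by simp
  qed
  moreover have "m t \<le> C\<^sup>2" for t
    unfolding m_def using random_measure_bound[OF _ f bd, of "max 0 t"] order_trans[OF abs_ge_zero bd]
    by (intro integral_le_const integrable_const_bound[where B="C\<^sup>2"]) (auto intro!: AE_I2 abs_le_imp_square_le)
  ultimately have "incseq (\<lambda>n. m (real n))" "\<forall>n. m (real n) \<le> C\<^sup>2"
    by (auto simp: mono_def)
  from incseq_convergent[OF this] obtain l where "(\<lambda>n. m (real n)) \<longlonglongrightarrow> l"
    by metis
  then show ?thesis
    using tendsto_at_topI_sequentially_real[OF \<open>mono m\<close>] unfolding m_def by blast
qed

text \<open>Polarization: the mass of \<open>A \<times> B\<close> is the mean of \<open>X Y\<close>, where \<open>X\<close> and \<open>Y\<close> are the random masses of \<open>A\<close>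
  and \<open>B\<close>, and the second moments of \<open>X + Y\<close>, \<open>X\<close> and \<open>Y\<close> converge by monotonicity.\<close>

lemma two_point_law_rectangle_converges:
  assumes A[measurable]: "A \<in> sets borel" and B[measurable]: "B \<in> sets borel"
  shows "\<exists>l. ((\<lambda>t. measure (two_point_law (max 0 t)) (A \<times> B)) \<longlongrightarrow> l) at_top"
proof -
  define m where "m f t = (\<integral>\<omega>. (\<integral>x. f (\<phi> (max 0 t) \<omega> x) \<partial>\<rho>)\<^sup>2 \<partial>M)" for f :: "'e \<Rightarrow> real" and t
  let ?a = "indicator A :: 'e \<Rightarrow> real" and ?b = "indicator B :: 'e \<Rightarrow> real"
  have bd: "\<bar>?a x\<bar> \<le> 1" "\<bar>?b x\<bar> \<le> 1" "\<bar>?a x + ?b x\<bar> \<le> 2" for x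
    by (auto split: split_indicator)
  obtain l where l: "(m (\<lambda>x. ?a x + ?b x) \<longlongrightarrow> l) at_top"
    using second_moment_converges[of "\<lambda>x. ?a x + ?b x", OF _ bd(3)] A B unfolding m_def[abs_def] by auto
  obtain la where la: "(m ?a \<longlongrightarrow> la) at_top"
    using second_moment_converges[of ?a, OF _ bd(1)] A unfolding m_def[abs_def] by auto
  obtain lb where lb: "(m ?b \<longlongrightarrow> lb) at_top"
    using second_moment_converges[of ?b, OF _ bd(2)] B unfolding m_def[abs_def] by auto
  have "measure (two_point_law (max 0 t)) (A \<times> B) = (m (\<lambda>x. ?a x + ?b x) t - m ?a t - m ?b t) / 2" for t
  proof -
    let ?t = "max 0 t"
    define X Y where "X \<omega> = (\<integral>x. ?a (\<phi> ?t \<omega> x) \<partial>\<rho>)" and "Y \<omega> = (\<integral>x. ?b (\<phi> ?t \<omega> x) \<partial>\<rho>)" for \<omega>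
    have [measurable]: "X \<in> borel_measurable M" "Y \<in> borel_measurable M"
      unfolding X_def Y_def using random_measure_bound(1)[of ?t] bd A B by auto
    have XY: "\<bar>X \<omega>\<bar> \<le> 1" "\<bar>Y \<omega>\<bar> \<le> 1" if "\<omega> \<in> space M" for \<omega>
      unfolding X_def Y_def 
      using random_measure_bound(2)[where t="?t" and f="?a" and \<omega>=\<omega>, OF _ _ bd(1)]
        random_measure_bound(2)[where t="?t" and f="?b" and \<omega>=\<omega>, OF _ _ bd(2)]
        A B that by auto
    have i: "integrable M (\<lambda>\<omega>. (X \<omega>)\<^sup>2)" "integrable M (\<lambda>\<omega>. (Y \<omega>)\<^sup>2)" "integrable M (\<lambda>\<omega>. X \<omega> * Y \<omega>)"
      using XY by (auto intro!: integrable_const_bound[where B=1] mult_le_one AE_I2 simp: abs_mult abs_square_le_1)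
    have "m (\<lambda>x. ?a x + ?b x) t = (\<integral>\<omega>. (X \<omega> + Y \<omega>)\<^sup>2 \<partial>M)"
      unfolding m_def X_def Y_def
      using random_measure_bound(3)[where t="?t" and f="?a", OF _ _ bd(1)]
        random_measure_bound(3)[where t="?t" and f="?b", OF _ _ bd(2)]
      by (intro Bochner_Integration.integral_cong refl arg_cong[where f="\<lambda>x. x\<^sup>2"] Bochner_Integration.integral_add) auto
    also have "\<dots> = (\<integral>\<omega>. (X \<omega>)\<^sup>2 + (Y \<omega>)\<^sup>2 + 2 * (X \<omega> * Y \<omega>) \<partial>M)"
      by (intro Bochner_Integration.integral_cong refl) (simp add: power2_sum)
    also have "\<dots> = m ?a t + m ?b t + 2 * (\<integral>\<omega>. X \<omega> * Y \<omega> \<partial>M)"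
      using i by (simp add: m_def X_def Y_def)
    finally show ?thesis
      using two_point_law_rectangle[OF _ A B, of ?t] by (simp add: X_def Y_def)
  qed
  then have "(\<lambda>t. measure (two_point_law (max 0 t)) (A \<times> B)) = (\<lambda>t. (m (\<lambda>x. ?a x + ?b x) t - m ?a t - m ?b t) / 2)"
    by (rule ext)
  moreover have "((\<lambda>t. (m (\<lambda>x. ?a x + ?b x) t - m ?a t - m ?b t) / 2) \<longlongrightarrow> (l - la - lb) / 2) at_top"
    by (intro tendsto_intros l la lb) simp
  ultimately show ?thesis by (intro exI) simp
qed

end

section \<open>The limiting coupling lives on the diagonal\<close>

context stationary_rds
begin

text \<open>The limit of the two-point laws is invariant for the two-point motion, because the latter maps the law
  at time \<open>t\<close> to the law at time \<open>t + s\<close> and preserves continuity of test functions.\<close>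

lemma invariant_coupling_exists:
  obtains R where "coupling \<rho> R"
    "\<And>f. continuous_on UNIV f \<Longrightarrow> (\<And>z. 0 \<le> f z) \<Longrightarrow> (\<And>z. f z \<le> (1::real)) \<Longrightarrow>
      ((\<lambda>t. \<integral>z. f z \<partial>two_point_law (max 0 t)) \<longlongrightarrow> (\<integral>z. f z \<partial>R)) at_top"
    "\<And>f s. continuous_on UNIV f \<Longrightarrow> (\<And>z. 0 \<le> f z) \<Longrightarrow> (\<And>z. f z \<le> (1::real)) \<Longrightarrow> 0 \<le> s \<Longrightarrow>
      (\<integral>z. P2 s f z \<partial>R) = (\<integral>z. f z \<partial>R)"
proof -
  obtain R where R: "coupling \<rho> R" and lim:
    "\<And>f. continuous_on UNIV f \<Longrightarrow> (\<And>z. 0 \<le> f z) \<Longrightarrow> (\<And>z. f z \<le> (1::real)) \<Longrightarrow>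
      ((\<lambda>t. \<integral>z. f z \<partial>two_point_law (max 0 t)) \<longlongrightarrow> (\<integral>z. f z \<partial>R)) at_top"
    by (rule couplings_converge_weakly[OF \<rho>.prob_space_axioms sets_rho trivial_limit_at_top_linorder
          two_point_law_coupling two_point_law_rectangle_converges]) auto
  have "(\<integral>z. P2 s f z \<partial>R) = (\<integral>z. f z \<partial>R)"
    if f: "continuous_on UNIV f" "\<And>z. 0 \<le> f z" "\<And>z. f z \<le> (1::real)" and s: "0 \<le> s" for f s
  proof (rule tendsto_unique[OF trivial_limit_at_top_linorder])
    have [measurable]: "f \<in> borel_measurable borel" using f(1) by (rule borel_measurable_continuous_onI)
    have bd: "\<bar>f z\<bar> \<le> 1" for z using f by simp
    have "P2 s f z \<le> 1" for z by (rule abs_le_D1, rule two_point_semigroup_abs_le[OF s _ bd]) simp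
    moreover have "0 \<le> P2 s f z" for z using f by (simp add: two_point_semigroup_def)
    ultimately show "((\<lambda>t. \<integral>z. P2 s f z \<partial>two_point_law (max 0 t)) \<longlongrightarrow> (\<integral>z. P2 s f z \<partial>R)) at_top"
      by (intro lim two_point_semigroup_continuous[OF s f(1) bd])
    have "filterlim (\<lambda>t. t + s) at_top at_top"
      by (subst add.commute) (rule filterlim_tendsto_add_at_top[OF tendsto_const filterlim_ident])
    then have "((\<lambda>t. \<integral>z. f z \<partial>two_point_law (max 0 (t + s))) \<longlongrightarrow> (\<integral>z. f z \<partial>R)) at_top"
      by (rule filterlim_compose[OF lim[OF f]])
    moreover have "\<forall>\<^sub>F t in at_top. (\<integral>z. f z \<partial>two_point_law (max 0 (t + s))) = (\<integral>z. P2 s f z \<partial>two_point_law (max 0 t))"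
      using eventually_ge_at_top[of 0]
    proof eventually_elim
      case (elim t)
      then show ?case using integral_two_point_law_add[of t s f 1] s bd by simp
    qed
    ultimately show "((\<lambda>t. \<integral>z. P2 s f z \<partial>two_point_law (max 0 t)) \<longlongrightarrow> (\<integral>z. f z \<partial>R)) at_top"
      by (rule Lim_transform_eventually)
  qed
  with R lim show thesis by (rule that)
qed

text \<open>Two points that meet stay together, so the diagonal can only gain mass; in the invariant coupling \<open>R\<close> it
  therefore gains none. But both marginals of \<open>R\<close> are \<open>\<rho>\<close>, so \<open>R\<close>-almost every pair lies in \<open>U \<times> U\<close>,
  and if off-diagonal pairs had positive mass, stability would push a fixed part of it arbitrarily close
  to the diagonal. The functions \<open>f k\<close> are continuous and decrease to the indicator of the diagonal,
  which makes both statements accessible to the invariance under continuous test functions.\<close>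

lemma invariant_coupling_diagonal:
  assumes stab: "weak_global_pointwise_stability M \<phi> \<rho>"
    and R: "coupling \<rho> R"
    and inv: "\<And>f s. continuous_on UNIV f \<Longrightarrow> (\<And>z. 0 \<le> f z) \<Longrightarrow> (\<And>z. f z \<le> (1::real)) \<Longrightarrow> 0 \<le> s \<Longrightarrow>
      (\<integral>z. P2 s f z \<partial>R) = (\<integral>z. f z \<partial>R)"
  shows "AE z in R. fst z = snd z"
proof -
  interpret R: prob_space R using R by (simp add: coupling_def)
  have sR [simp, measurable_cong]: "sets R = sets borel" using R by (simp add: coupling_def)
  have spR [simp]: "space R = UNIV" using sets_eq_imp_space_eq[OF sR] by simp
  obtain U \<tau> where U[measurable]: "U \<in> sets borel" and U1: "measure \<rho> U = 1" and "\<forall>n::nat. 0 \<le> \<tau> n"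
    and \<delta>: "\<forall>x\<in>U. \<forall>y\<in>U. \<exists>\<delta>>0. \<forall>\<eta>>0. ereal \<delta> \<le>
          liminf (\<lambda>n. ereal (prob {\<omega> \<in> space M. dist (\<phi> (\<tau> n) \<omega> x) (\<phi> (\<tau> n) \<omega> y) \<le> \<eta>}))"
    using stab unfolding weak_global_pointwise_stability_def by (elim exE conjE) (rule that; assumption)
  then have \<tau>: "0 \<le> \<tau> n" for n by simp
  define D where "D = {z :: 'e \<times> 'e. fst z = snd z}"
  have "closed D" unfolding D_def by (intro closed_Collect_eq continuous_intros)
  then have D[measurable]: "D \<in> sets borel" by simp
  define f where "f k z = max 0 (1 - real (Suc k) * dist (fst z) (snd z))" for k and z :: "'e \<times> 'e"
  have f: "continuous_on UNIV (f k)" "0 \<le> f k z" "f k z \<le> 1" for k z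
    unfolding f_def by (auto intro!: continuous_intros)
  have fm[measurable]: "f k \<in> borel_measurable borel" for k by (rule borel_measurable_continuous_onI[OF f(1)])
  have bd: "\<bar>f k z\<bar> \<le> 1" for k z using f(2,3)[of k z] by simp
  have P: "P2 (\<tau> n) (f k) \<in> borel_measurable borel" "0 \<le> P2 (\<tau> n) (f k) z" "P2 (\<tau> n) (f k) z \<le> 1" for n k z
    by (rule two_point_semigroup_measurable[OF \<tau> fm], simp add: two_point_semigroup_def f,
      rule abs_le_D1, rule two_point_semigroup_abs_le[OF \<tau> fm bd])
  note [measurable] = P(1)
  have PD: "P2 (\<tau> n) (f k) z = 1" if "z \<in> D" for n k z
    using that prob_space by (simp add: D_def two_point_semigroup_def f_def)
  define J where "J k n z = indicator (- D) z * P2 (\<tau> n) (f k) z" for k n z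
  have J[measurable]: "J k n \<in> borel_measurable borel" and J0: "0 \<le> J k n z" and J1: "J k n z \<le> 1" for k n z
    unfolding J_def using P(2,3)[of n k z] by (auto split: split_indicator intro!: mult_le_one)
  \<comment> \<open>The mass, weighted by \<open>f k\<close>, that \<open>R\<close> has near, but not on, the diagonal. By invariance it is also the mean of \<open>J k n\<close>,
    the contribution of the off-diagonal starting pairs, for every \<open>n\<close>.\<close>
  define c where "c k = (\<integral>z. f k z \<partial>R) - measure R D" for k
  have intJ: "integrable R (J k n)" for k n
    by (rule R.integrable_const_bound[where B=1]) (use J0 J1 in auto)
  have cJ: "(\<integral>z. J k n z \<partial>R) = c k" for k n
  proof -
    have "(\<integral>z. f k z \<partial>R) = (\<integral>z. P2 (\<tau> n) (f k) z \<partial>R)"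
      by (rule inv[OF f \<tau>, symmetric])
    also have "\<dots> = (\<integral>z. indicator D z + J k n z \<partial>R)"
      by (intro Bochner_Integration.integral_cong refl) (auto simp: J_def PD split: split_indicator)
    also have "\<dots> = measure R D + (\<integral>z. J k n z \<partial>R)"
      using intJ by (subst Bochner_Integration.integral_add) (auto simp: less_top[symmetric])
    finally show ?thesis by (simp add: c_def)
  qed
  have "(\<lambda>k. \<integral>z. f k z \<partial>R) \<longlonglongrightarrow> (\<integral>z. indicator D z \<partial>R)"
  proof (rule integral_dominated_convergence[where w="\<lambda>_. 1"])
    show "AE z in R. (\<lambda>k. f k z) \<longlonglongrightarrow> indicator D z"
    proof (rule AE_I2)
      fix z
      show "(\<lambda>k. f k z) \<longlonglongrightarrow> indicator D z"
      proof (cases "z \<in> D")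
        case True
        then show ?thesis by (simp add: f_def D_def)
      next
        case False
        then have "0 < dist (fst z) (snd z)" by (simp add: D_def)
        then obtain N where N: "1 < real N * dist (fst z) (snd z)"
          using reals_Archimedean3 by blast
        have "f k z = 0" if "N \<le> k" for k
        proof -
          have "real N * dist (fst z) (snd z) \<le> real (Suc k) * dist (fst z) (snd z)"
            using that by (intro mult_right_mono) auto
          with N show ?thesis by (simp add: f_def)
        qed
        then have "\<forall>\<^sub>F k in sequentially. f k z = 0"
          using eventually_sequentially by blast
        then show ?thesis using False by (simp add: tendsto_eventually)
      qed
    qed
  qed (use bd in auto)
  then have c0: "c \<longlonglongrightarrow> 0"
    using LIM_zero[of "\<lambda>k. \<integral>z. f k z \<partial>R" "measure R D" sequentially] by (simp add: c_def[abs_def])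
  \<comment> \<open>Fatou's lemma bounds the mean of \<open>L\<close> by every \<open>c k\<close>, and \<open>c k\<close> tends to \<open>0\<close>; stability makes \<open>L\<close>
    positive off the diagonal.\<close>
  define L where "L z = (INF k. liminf (\<lambda>n. ennreal (J k n z)))" for z
  have [measurable]: "L \<in> borel_measurable borel" unfolding L_def by measurable
  have "(\<integral>\<^sup>+z. L z \<partial>R) \<le> ennreal (c k)" for k
  proof -
    have "(\<integral>\<^sup>+z. L z \<partial>R) \<le> (\<integral>\<^sup>+z. liminf (\<lambda>n. ennreal (J k n z)) \<partial>R)"
      unfolding L_def by (intro nn_integral_mono INF_lower) simp
    also have "\<dots> \<le> liminf (\<lambda>n. \<integral>\<^sup>+z. ennreal (J k n z) \<partial>R)"
      by (rule nn_integral_liminf) measurable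
    also have "\<dots> = ennreal (c k)"
      using J0 cJ intJ by (subst nn_integral_eq_integral) (auto simp: Liminf_const)
    finally show ?thesis .
  qed
  moreover have "(\<lambda>k. ennreal (c k)) \<longlonglongrightarrow> ennreal 0" by (rule tendsto_ennrealI[OF c0])
  ultimately have "(\<integral>\<^sup>+z. L z \<partial>R) = 0"
    using LIMSEQ_le_const[of "\<lambda>k. ennreal (c k)" 0 "\<integral>\<^sup>+z. L z \<partial>R"] by simp
  then have L0: "AE z in R. L z = 0"
    by (subst (asm) nn_integral_0_iff_AE) auto
  have "measure \<rho> (- U) = 0"
    using \<rho>.prob_compl[of U] U1 by (simp add: Compl_eq_Diff_UNIV)
  then have "measure R ((- U) \<times> UNIV) = 0" "measure R (UNIV \<times> (- U)) = 0"
    using R U by (auto simp: coupling_def)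
  then have "AE z in R. z \<notin> (- U) \<times> UNIV" "AE z in R. z \<notin> UNIV \<times> (- U)"
    by (auto intro!: AE_not_in simp: null_sets_def R.emeasure_eq_measure)
  with L0 show ?thesis
  proof eventually_elim
    case (elim z)
    then have "fst z \<in> U" "snd z \<in> U" by (auto simp: mem_Times_iff)
    with \<delta> obtain d where d: "0 < d" "\<And>\<eta>. 0 < \<eta> \<Longrightarrow> ereal d \<le>
          liminf (\<lambda>n. ereal (prob {\<omega> \<in> space M. dist (\<phi> (\<tau> n) \<omega> (fst z)) (\<phi> (\<tau> n) \<omega> (snd z)) \<le> \<eta>}))"
      by blast
    show ?case
    proof (rule ccontr)
      assume "fst z \<noteq> snd z"
      then have zD: "z \<notin> D" by (simp add: D_def)
      have "ennreal (d / 4) \<le> liminf (\<lambda>n. ennreal (J k n z))" for k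
      proof (rule Liminf_bounded)
        \<comment> \<open>Within this distance of the diagonal \<open>f k\<close> is at least \<open>1 / 2\<close>.\<close>
        define \<eta> where "\<eta> = 1 / (2 * real (Suc k))"
        have "0 < \<eta>" by (simp add: \<eta>_def)
        let ?A = "\<lambda>n. {\<omega> \<in> space M. dist (\<phi> (\<tau> n) \<omega> (fst z)) (\<phi> (\<tau> n) \<omega> (snd z)) \<le> \<eta>}"
        have "\<forall>\<^sub>F n in sequentially. ereal (d / 2) < ereal (prob (?A n))"
        proof -
          have "ereal (d / 2) < ereal d" using d(1) by simp
          with d(2)[OF \<open>0 < \<eta>\<close>] show ?thesis unfolding le_Liminf_iff by blast
        qed
        then show "\<forall>\<^sub>F n in sequentially. ennreal (d / 4) \<le> ennreal (J k n z)"
        proof eventually_elim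
          case (elim n)
          have [measurable]: "?A n \<in> sets M" using \<tau> by measurable
          have le: "1 / 2 * indicator (?A n) \<omega> \<le> f k (\<phi> (\<tau> n) \<omega> (fst z), \<phi> (\<tau> n) \<omega> (snd z))"
            if "\<omega> \<in> space M" for \<omega>
          proof (cases "\<omega> \<in> ?A n")
            case True
            then have "real (Suc k) * dist (\<phi> (\<tau> n) \<omega> (fst z)) (\<phi> (\<tau> n) \<omega> (snd z)) \<le> real (Suc k) * \<eta>"
              by (intro mult_left_mono) auto
            also have "\<dots> = 1 / 2" by (simp add: \<eta>_def field_simps)
            finally show ?thesis using True by (simp add: f_def)
          qed (use f in auto)
          have "1 / 2 * prob (?A n) = (\<integral>\<omega>. 1 / 2 * indicator (?A n) \<omega> \<partial>M)"
            by simp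
          also have "\<dots> \<le> P2 (\<tau> n) (f k) z"
            unfolding two_point_semigroup_def
            by (intro integral_mono le two_point_integrable[OF \<tau> fm bd]) (auto simp: less_top[symmetric])
          finally show ?case
            using elim zD by (intro ennreal_leI) (simp add: J_def)
        qed
      qed
      then have "ennreal (d / 4) \<le> L z" unfolding L_def by (intro INF_greatest)
      with elim d(1) show False by simp
    qed
  qed
qed

end

text \<open>A bounded metric for the same topology; its mean metrizes convergence in probability.\<close>

definition capped_dist :: "'a::metric_space \<times> 'a \<Rightarrow> real" where
  "capped_dist z = min 1 (dist (fst z) (snd z))"

lemma capped_dist_continuous: "continuous_on UNIV capped_dist"
  unfolding capped_dist_def[abs_def] by (intro continuous_intros)

lemma capped_dist_measurable [measurable]:
  "(capped_dist :: 'a::{metric_space,second_countable_topology} \<times> 'a \<Rightarrow> real) \<in> borel_measurable borel"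
  by (rule borel_measurable_continuous_onI[OF capped_dist_continuous])

lemma capped_dist_bounds: "0 \<le> capped_dist z" "capped_dist z \<le> 1" "\<bar>capped_dist z\<bar> \<le> 1"
  by (auto simp: capped_dist_def)

lemma capped_dist_triangle: "capped_dist (x, z) \<le> capped_dist (x, y) + capped_dist (y, z)"
  using dist_triangle[of x z y] zero_le_dist[of x y] zero_le_dist[of y z]
  unfolding capped_dist_def fst_conv snd_conv by linarith

lemma capped_dist_commute: "capped_dist (x, y) = capped_dist (y, x)"
  by (simp add: capped_dist_def dist_commute)

lemma capped_dist_eq_0 [simp]: "capped_dist (x, y) = 0 \<longleftrightarrow> x = y"
  by (auto simp: capped_dist_def min_def)

context stationary_rds
begin

lemma stationary_pair_gap_tendsto_0:
  assumes "weak_global_pointwise_stability M \<phi> \<rho>"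
  shows "((\<lambda>t. \<integral>z. P2 t capped_dist z \<partial>(\<rho> \<Otimes>\<^sub>M \<rho>)) \<longlongrightarrow> 0) at_top"
proof -
  obtain R where R: "coupling \<rho> R" and lim:
    "\<And>f. continuous_on UNIV f \<Longrightarrow> (\<And>z. 0 \<le> f z) \<Longrightarrow> (\<And>z. f z \<le> (1::real)) \<Longrightarrow>
      ((\<lambda>t. \<integral>z. f z \<partial>two_point_law (max 0 t)) \<longlongrightarrow> (\<integral>z. f z \<partial>R)) at_top"
    and inv: "\<And>f s. continuous_on UNIV f \<Longrightarrow> (\<And>z. 0 \<le> f z) \<Longrightarrow> (\<And>z. f z \<le> (1::real)) \<Longrightarrow> 0 \<le> s \<Longrightarrow>
      (\<integral>z. P2 s f z \<partial>R) = (\<integral>z. f z \<partial>R)"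
    by (rule invariant_coupling_exists) blast
  have "AE z in R. fst z = snd z"
    by (rule invariant_coupling_diagonal[OF assms R]) (rule inv)
  then have "AE z in R. capped_dist z = 0"
    by eventually_elim (simp add: capped_dist_def)
  then have "(\<integral>z. capped_dist z \<partial>R) = 0" by (rule integral_eq_zero_AE)
  with lim[OF capped_dist_continuous capped_dist_bounds(1,2)]
  have "((\<lambda>t. \<integral>z. capped_dist z \<partial>two_point_law (max 0 t)) \<longlongrightarrow> 0) at_top" by simp
  moreover have "\<forall>\<^sub>F t in at_top. (\<integral>z. capped_dist z \<partial>two_point_law (max 0 t)) = (\<integral>z. P2 t capped_dist z \<partial>(\<rho> \<Otimes>\<^sub>M \<rho>))"
    using eventually_ge_at_top[of 0]
    by eventually_elim (simp add: integral_two_point_law(2)[OF _ capped_dist_measurable capped_dist_bounds(3)])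
  ultimately show ?thesis by (rule Lim_transform_eventually)
qed

end

section \<open>From stationary to arbitrary starting points\<close>

context stationary_rds
begin

text \<open>The comparison of \<open>x\<close> with a stationary point. It serves to bound the gap of two points by a sum in
  which they enter separately, so that the bound survives averaging over arbitrarily correlated pairs.\<close>

definition mean_gap :: "real \<Rightarrow> 'e \<Rightarrow> real" where
  "mean_gap t x = (\<integral>y. P2 t capped_dist (x, y) \<partial>\<rho>)"

lemma pair_gap_bounds:
  assumes "0 \<le> t"
  shows "0 \<le> P2 t capped_dist z" "P2 t capped_dist z \<le> 1" "\<bar>P2 t capped_dist z\<bar> \<le> 1"
proof -
  show "0 \<le> P2 t capped_dist z" by (simp add: two_point_semigroup_def capped_dist_bounds)
  show "\<bar>P2 t capped_dist z\<bar> \<le> 1"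
    by (rule two_point_semigroup_abs_le[OF assms capped_dist_measurable capped_dist_bounds(3)])
  then show "P2 t capped_dist z \<le> 1" by simp
qed

lemma pair_gap_integrable:
  assumes "0 \<le> t"
  shows "integrable M (\<lambda>\<omega>. capped_dist (\<phi> t \<omega> x, \<phi> t \<omega> y))"
  by (rule two_point_integrable[OF assms capped_dist_measurable capped_dist_bounds(3)])

lemma pair_gap_triangle:
  assumes "0 \<le> t"
  shows "P2 t capped_dist (x, z) \<le> P2 t capped_dist (x, y) + P2 t capped_dist (z, y)"
proof -
  have "P2 t capped_dist (x, z) \<le>
    (\<integral>\<omega>. capped_dist (\<phi> t \<omega> x, \<phi> t \<omega> y) + capped_dist (\<phi> t \<omega> z, \<phi> t \<omega> y) \<partial>M)"
    unfolding two_point_semigroup_def fst_conv snd_conv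
  proof (intro integral_mono Bochner_Integration.integrable_add pair_gap_integrable assms)
    fix \<omega>
    show "capped_dist (\<phi> t \<omega> x, \<phi> t \<omega> z) \<le> capped_dist (\<phi> t \<omega> x, \<phi> t \<omega> y) + capped_dist (\<phi> t \<omega> z, \<phi> t \<omega> y)"
      using capped_dist_triangle[of "\<phi> t \<omega> x" "\<phi> t \<omega> z" "\<phi> t \<omega> y"]
        capped_dist_commute[of "\<phi> t \<omega> y" "\<phi> t \<omega> z"] by linarith
  qed
  also have "\<dots> = P2 t capped_dist (x, y) + P2 t capped_dist (z, y)"
    unfolding two_point_semigroup_def fst_conv snd_conv
    by (intro Bochner_Integration.integral_add pair_gap_integrable assms)
  finally show ?thesis .
qed

lemma pair_gap_measurable:
  assumes "0 \<le> t"
  shows "P2 t capped_dist \<in> borel_measurable (borel \<Otimes>\<^sub>M borel)"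
  using two_point_semigroup_measurable[OF assms capped_dist_measurable] by (simp add: borel_prod)

lemma pair_gap_integrable_rho:
  assumes "0 \<le> t"
  shows "integrable \<rho> (\<lambda>y. P2 t capped_dist (x, y))"
proof (rule \<rho>.integrable_const_bound[where B=1])
  note [measurable] = pair_gap_measurable[OF assms]
  show "(\<lambda>y. P2 t capped_dist (x, y)) \<in> borel_measurable \<rho>" by measurable
qed (use pair_gap_bounds[OF assms] in auto)

lemma mean_gap_bounds:
  assumes "0 \<le> t"
  shows "0 \<le> mean_gap t x" "mean_gap t x \<le> 1" "\<bar>mean_gap t x\<bar> \<le> 1"
proof -
  show 1: "0 \<le> mean_gap t x" unfolding mean_gap_def using pair_gap_bounds[OF assms] by simp
  show 2: "mean_gap t x \<le> 1"
    unfolding mean_gap_def using pair_gap_bounds[OF assms]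
    by (intro \<rho>.integral_le_const pair_gap_integrable_rho assms) auto
  show "\<bar>mean_gap t x\<bar> \<le> 1" using 1 2 by simp
qed

text \<open>Triangle inequality with a third point that is averaged with respect to \<open>\<rho>\<close>.\<close>

lemma pair_gap_le_mean_gap:
  assumes "0 \<le> t"
  shows "P2 t capped_dist (x, z) \<le> mean_gap t x + mean_gap t z"
proof -
  have "P2 t capped_dist (x, z) = (\<integral>y. P2 t capped_dist (x, z) \<partial>\<rho>)"
    using \<rho>.prob_space by simp
  also have "\<dots> \<le> (\<integral>y. P2 t capped_dist (x, y) + P2 t capped_dist (z, y) \<partial>\<rho>)"
    by (intro integral_mono Bochner_Integration.integrable_add pair_gap_integrable_rho pair_gap_triangle assms) simp
  also have "\<dots> = mean_gap t x + mean_gap t z"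
    unfolding mean_gap_def by (intro Bochner_Integration.integral_add pair_gap_integrable_rho assms)
  finally show ?thesis .
qed

lemma mean_gap_continuous:
  assumes "0 \<le> t"
  shows "continuous_on UNIV (mean_gap t)"
  unfolding continuous_on_sequentially
proof (intro allI ballI impI, elim conjE)
  fix x :: "nat \<Rightarrow> 'e" and a assume x: "x \<longlonglongrightarrow> a"
  note [measurable] = pair_gap_measurable[OF assms]
  show "(mean_gap t \<circ> x) \<longlonglongrightarrow> mean_gap t a"
    unfolding mean_gap_def comp_def
  proof (rule integral_dominated_convergence[where w="\<lambda>_. 1"])
    show "AE y in \<rho>. (\<lambda>n. P2 t capped_dist (x n, y)) \<longlonglongrightarrow> P2 t capped_dist (a, y)"
      by (intro AE_I2 continuous_on_tendsto_compose[OF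
            two_point_semigroup_continuous[OF assms capped_dist_continuous capped_dist_bounds(3)]]
          tendsto_Pair x tendsto_const) auto
    show "(\<lambda>y. P2 t capped_dist (a, y)) \<in> borel_measurable \<rho>" by measurable
    show "(\<lambda>y. P2 t capped_dist (x n, y)) \<in> borel_measurable \<rho>" for n by measurable
  qed (use pair_gap_bounds[OF assms] in auto)
qed

lemma mean_gap_measurable [measurable]: "0 \<le> t \<Longrightarrow> mean_gap t \<in> borel_measurable borel"
  by (rule borel_measurable_continuous_onI[OF mean_gap_continuous])

lemma integral_mean_gap:
  assumes "0 \<le> t"
  shows "(\<integral>x. mean_gap t x \<partial>\<rho>) = (\<integral>z. P2 t capped_dist z \<partial>(\<rho> \<Otimes>\<^sub>M \<rho>))"
proof -
  note [measurable] = pair_gap_measurable[OF assms]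
  have "integrable (\<rho> \<Otimes>\<^sub>M \<rho>) (P2 t capped_dist)"
    by (rule \<rho>\<rho>.integrable_const_bound[where B=1]) (use pair_gap_bounds[OF assms] in auto)
  from \<rho>\<rho>.integral_fst'[OF this] show ?thesis by (simp add: mean_gap_def)
qed

lemma mean_gap_compose_integrable:
  assumes "0 \<le> r" "0 \<le> s"
  shows "integrable M (\<lambda>\<omega>. mean_gap s (\<phi> r \<omega> x))"
proof (rule integrable_const_bound[where B=1])
  note [measurable] = mean_gap_measurable[OF assms(2)]
  show "(\<lambda>\<omega>. mean_gap s (\<phi> r \<omega> x)) \<in> borel_measurable M" using assms by measurable
qed (use mean_gap_bounds[OF assms(2)] in auto)

text \<open>After time \<open>r\<close> the two points are arbitrarily correlated, but the bound on the pair gap by two mean gaps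
  involves the law of each point separately: the first is the law of \<open>\<phi> r\<close> started in \<open>x\<close>, the second is \<open>\<rho>\<close>.\<close>

lemma mean_gap_add_le:
  assumes r: "0 \<le> r" and s: "0 \<le> s"
  shows "mean_gap (r + s) x \<le> markov_semigroup M \<phi> r (mean_gap s) x + (\<integral>y. mean_gap s y \<partial>\<rho>)"
proof -
  note [measurable] = mean_gap_measurable[OF s]
  have int: "integrable \<rho> (\<lambda>y. markov_semigroup M \<phi> r (mean_gap s) y)"
  proof (rule \<rho>.integrable_const_bound[where B=1])
    show "(\<lambda>y. markov_semigroup M \<phi> r (mean_gap s) y) \<in> borel_measurable \<rho>"
      unfolding markov_semigroup_def using r by measurable
    have "\<bar>markov_semigroup M \<phi> r (mean_gap s) y\<bar> \<le> 1" for y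
      unfolding markov_semigroup_def
      using mean_gap_bounds[OF s] mean_gap_compose_integrable[OF r s]
      by (simp add: abs_of_nonneg Bochner_Integration.integral_nonneg integral_le_const)
    then show "AE y in \<rho>. norm (markov_semigroup M \<phi> r (mean_gap s) y) \<le> 1" by simp
  qed
  have le: "P2 (r + s) capped_dist (x, y) \<le> markov_semigroup M \<phi> r (mean_gap s) x + markov_semigroup M \<phi> r (mean_gap s) y" for y
  proof -
    have "P2 (r + s) capped_dist (x, y) = P2 r (P2 s capped_dist) (x, y)"
      by (rule two_point_semigroup_add[OF r s capped_dist_measurable capped_dist_bounds(3)])
    also have "\<dots> = (\<integral>\<omega>. P2 s capped_dist (\<phi> r \<omega> x, \<phi> r \<omega> y) \<partial>M)"
      by (simp add: two_point_semigroup_def[of M \<phi> r])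
    also have "\<dots> \<le> (\<integral>\<omega>. mean_gap s (\<phi> r \<omega> x) + mean_gap s (\<phi> r \<omega> y) \<partial>M)"
      by (intro integral_mono pair_gap_le_mean_gap Bochner_Integration.integrable_add mean_gap_compose_integrable
          two_point_integrable[OF r two_point_semigroup_measurable[OF s capped_dist_measurable] pair_gap_bounds(3)[OF s]] r s)
    also have "\<dots> = markov_semigroup M \<phi> r (mean_gap s) x + markov_semigroup M \<phi> r (mean_gap s) y"
      unfolding markov_semigroup_def by (intro Bochner_Integration.integral_add mean_gap_compose_integrable r s)
    finally show ?thesis .
  qed
  have "mean_gap (r + s) x \<le> (\<integral>y. markov_semigroup M \<phi> r (mean_gap s) x + markov_semigroup M \<phi> r (mean_gap s) y \<partial>\<rho>)"
    unfolding mean_gap_def[of "r + s"]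
    by (intro integral_mono pair_gap_integrable_rho le Bochner_Integration.integrable_add int) (use r s in auto)
  also have "\<dots> = markov_semigroup M \<phi> r (mean_gap s) x + (\<integral>y. markov_semigroup M \<phi> r (mean_gap s) y \<partial>\<rho>)"
    using int \<rho>.prob_space by (subst Bochner_Integration.integral_add) auto
  also have "(\<integral>y. markov_semigroup M \<phi> r (mean_gap s) y \<partial>\<rho>) = (\<integral>y. mean_gap s y \<partial>\<rho>)"
  proof -
    have "bounded (range (mean_gap s))" using mean_gap_bounds[OF s] by (auto simp: bounded_iff)
    with invariant r show ?thesis by (simp add: invariant_prob_def)
  qed
  finally show ?thesis .
qed

text \<open>Strong mixing transfers the stationary estimate to the starting point \<open>x\<close>: for fixed \<open>s\<close> the function
  \<open>mean_gap s\<close> is bounded and continuous, and its \<open>\<rho>\<close>-mean is small for large \<open>s\<close>.\<close>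

lemma markov_mean_gap_small:
  assumes mix: "strongly_mixing M \<phi> \<rho>" and stab: "weak_global_pointwise_stability M \<phi> \<rho>" and e: "0 < e"
  shows "\<exists>S\<ge>0. \<forall>s\<ge>S. \<exists>T\<ge>0. \<forall>r\<ge>T. markov_semigroup M \<phi> r (mean_gap s) x < e \<and> (\<integral>y. mean_gap s y \<partial>\<rho>) < e"
proof -
  have "\<forall>\<^sub>F s in at_top. (\<integral>z. P2 s capped_dist z \<partial>(\<rho> \<Otimes>\<^sub>M \<rho>)) < e"
    using order_tendstoD(2)[OF stationary_pair_gap_tendsto_0[OF stab] e] .
  then obtain S where S: "\<And>s. S \<le> s \<Longrightarrow> (\<integral>z. P2 s capped_dist z \<partial>(\<rho> \<Otimes>\<^sub>M \<rho>)) < e"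
    by (auto simp: eventually_at_top_linorder)
  have "\<exists>T\<ge>0. \<forall>r\<ge>T. markov_semigroup M \<phi> r (mean_gap s) x < e \<and> (\<integral>y. mean_gap s y \<partial>\<rho>) < e"
    if s: "max 0 S \<le> s" for s
  proof -
    have s0: "0 \<le> s" and lt: "(\<integral>y. mean_gap s y \<partial>\<rho>) < e"
      using s S[of s] integral_mean_gap[of s] by auto
    have "bounded (range (mean_gap s))" using mean_gap_bounds[OF s0] by (auto simp: bounded_iff)
    with mix mean_gap_continuous[OF s0]
    have "((\<lambda>r. markov_semigroup M \<phi> r (mean_gap s) x) \<longlongrightarrow> (\<integral>y. mean_gap s y \<partial>\<rho>)) at_top"
      by (simp add: strongly_mixing_def)
    from order_tendstoD(2)[OF this lt]
    obtain T where "\<And>r. T \<le> r \<Longrightarrow> markov_semigroup M \<phi> r (mean_gap s) x < e"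
      by (auto simp: eventually_at_top_linorder)
    with lt show ?thesis by (intro exI[of _ "max 0 T"]) auto
  qed
  then show ?thesis by (intro exI[of _ "max 0 S"]) auto
qed

lemma mean_gap_tendsto_0:
  assumes mix: "strongly_mixing M \<phi> \<rho>" and stab: "weak_global_pointwise_stability M \<phi> \<rho>"
  shows "((\<lambda>t. mean_gap t x) \<longlongrightarrow> 0) at_top"
proof (rule order_tendstoI)
  fix e :: real assume "e < 0"
  show "\<forall>\<^sub>F t in at_top. e < mean_gap t x"
    using eventually_ge_at_top[of 0]
  proof eventually_elim
    case (elim t)
    with mean_gap_bounds(1)[OF elim, of x] \<open>e < 0\<close> show ?case by simp
  qed
next
  fix e :: real assume "0 < e"
  then obtain s T where sT: "0 \<le> s" "0 \<le> T"
    "\<And>r. T \<le> r \<Longrightarrow> markov_semigroup M \<phi> r (mean_gap s) x < e / 2 \<and> (\<integral>y. mean_gap s y \<partial>\<rho>) < e / 2"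
    using markov_mean_gap_small[OF mix stab, of "e / 2" x] by auto
  show "\<forall>\<^sub>F t in at_top. mean_gap t x < e"
    using eventually_ge_at_top[of "T + s"]
  proof eventually_elim
    case (elim t)
    then show ?case
      using sT(3)[of "t - s"] mean_gap_add_le[of "t - s" s x] sT(1,2) by simp
  qed
qed

section \<open>The pullback trajectories converge\<close>

text \<open>The position at time \<open>0\<close> of the trajectory that starts in \<open>x\<close> at time \<open>- t\<close>.\<close>

definition pullback :: "'e \<Rightarrow> real \<Rightarrow> 'w \<Rightarrow> 'e" where
  "pullback x t \<omega> = \<phi> t (\<theta> (- t) \<omega>) x"

lemma pullback_measurable:
  assumes "0 \<le> t"
  shows "pullback x t \<in> F (- t) 0 \<rightarrow>\<^sub>M borel"
proof -
  have "\<theta> (- t) \<in> F (- t) 0 \<rightarrow>\<^sub>M F 0 t"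
    using flow_noise_measurable[of 0 t "- t"] assms by simp
  from measurable_compose[OF this cocycle_noise_measurable[OF assms]]
  show ?thesis by (simp add: pullback_def[abs_def])
qed

lemma pullback_measurable_M [measurable]:
  assumes "0 \<le> t"
  shows "pullback x t \<in> M \<rightarrow>\<^sub>M borel"
  using measurable_from_subalg[OF noise_subalgebra pullback_measurable] assms by simp

text \<open>Starting earlier by \<open>r\<close> means that at time \<open>- s\<close> the trajectory is at a random point depending on
  older noise, whereas the later start is at \<open>x\<close>. From then on both points use the same noise.\<close>

lemma pullback_gap_le:
  assumes r: "0 \<le> r" and s: "0 \<le> s"
  shows "(\<integral>\<omega>. capped_dist (pullback x (r + s) \<omega>, pullback x s \<omega>) \<partial>M) \<le>
    markov_semigroup M \<phi> r (mean_gap s) x + mean_gap s x"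
proof -
  have rs: "0 \<le> r + s" using r s by simp
  let ?f = "\<lambda>\<omega>. capped_dist (\<phi> s (\<theta> r \<omega>) (\<phi> r \<omega> x), \<phi> s (\<theta> r \<omega>) x)"
  let ?Z = "\<lambda>\<omega>. (\<phi> r \<omega> x, x)"
  have f: "?f \<in> borel_measurable M"
    using r s by measurable
  have Z: "?Z \<in> F 0 r \<rightarrow>\<^sub>M borel"
    unfolding borel_prod[symmetric] by (intro measurable_Pair cocycle_noise_measurable r) simp
  have "(\<integral>\<omega>. capped_dist (pullback x (r + s) \<omega>, pullback x s \<omega>) \<partial>M) = (\<integral>\<omega>. ?f (\<theta> (- (r + s)) \<omega>) \<partial>M)"
  proof (intro Bochner_Integration.integral_cong refl)
    fix \<omega> assume \<omega>: "\<omega> \<in> space M"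
    then have \<omega>': "\<theta> (- (r + s)) \<omega> \<in> space M" by (rule measurable_space[OF flow_measurable_at])
    have "\<theta> r (\<theta> (- (r + s)) \<omega>) = \<theta> (- s) \<omega>"
      using flow_add[OF \<omega>, of r "- (r + s)"] by simp
    moreover have "\<phi> (r + s) (\<theta> (- (r + s)) \<omega>) x = \<phi> s (\<theta> r (\<theta> (- (r + s)) \<omega>)) (\<phi> r (\<theta> (- (r + s)) \<omega>) x)"
      using cocycle_add[OF r s \<omega>', of x] by (simp add: add.commute)
    ultimately show "capped_dist (pullback x (r + s) \<omega>, pullback x s \<omega>) = ?f (\<theta> (- (r + s)) \<omega>)"
      by (simp add: pullback_def)
  qed
  also have "\<dots> = (\<integral>\<omega>. ?f \<omega> \<partial>M)" by (rule integral_flow[OF f])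
  also have "\<dots> = (\<integral>\<omega>. P2 s capped_dist (\<phi> r \<omega> x, x) \<partial>M)"
    using fresh_noise[OF r s Z capped_dist_measurable capped_dist_bounds(3)] by simp
  also have "\<dots> \<le> (\<integral>\<omega>. mean_gap s (\<phi> r \<omega> x) + mean_gap s x \<partial>M)"
  proof (intro integral_mono pair_gap_le_mean_gap Bochner_Integration.integrable_add mean_gap_compose_integrable r s)
    show "integrable M (\<lambda>\<omega>. P2 s capped_dist (\<phi> r \<omega> x, x))"
    proof (rule integrable_const_bound[where B=1])
      note [measurable] = pair_gap_measurable[OF s]
      show "(\<lambda>\<omega>. P2 s capped_dist (\<phi> r \<omega> x, x)) \<in> borel_measurable M" using r by measurable
    qed (use pair_gap_bounds[OF s] in auto)
  qed simp
  also have "\<dots> = markov_semigroup M \<phi> r (mean_gap s) x + mean_gap s x"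
    unfolding markov_semigroup_def using prob_space mean_gap_compose_integrable[OF r s]
    by (subst Bochner_Integration.integral_add) auto
  finally show ?thesis .
qed

end

lemma (in prob_space) mean_capped_dist_triangle:
  assumes [measurable]: "X \<in> borel_measurable M" "Y \<in> borel_measurable M" "Z \<in> borel_measurable M"
  shows "(\<integral>\<omega>. capped_dist (X \<omega>, Z \<omega> :: 'b::{metric_space,second_countable_topology}) \<partial>M) \<le>
    (\<integral>\<omega>. capped_dist (X \<omega>, Y \<omega>) \<partial>M) + (\<integral>\<omega>. capped_dist (Y \<omega>, Z \<omega>) \<partial>M)"
proof -
  have int: "integrable M (\<lambda>\<omega>. capped_dist (f \<omega>, g \<omega>))"
    if [measurable]: "f \<in> borel_measurable M" "g \<in> borel_measurable M" for f g :: "'a \<Rightarrow> 'b"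
  proof (rule integrable_const_bound[where B=1])
    show "(\<lambda>\<omega>. capped_dist (f \<omega>, g \<omega>)) \<in> borel_measurable M"
      unfolding capped_dist_def by measurable
  qed (simp add: capped_dist_bounds)
  have "(\<integral>\<omega>. capped_dist (X \<omega>, Z \<omega>) \<partial>M) \<le> (\<integral>\<omega>. capped_dist (X \<omega>, Y \<omega>) + capped_dist (Y \<omega>, Z \<omega>) \<partial>M)"
    by (intro integral_mono int Bochner_Integration.integrable_add capped_dist_triangle assms)
  also have "\<dots> = (\<integral>\<omega>. capped_dist (X \<omega>, Y \<omega>) \<partial>M) + (\<integral>\<omega>. capped_dist (Y \<omega>, Z \<omega>) \<partial>M)"
    by (intro Bochner_Integration.integral_add int assms)
  finally show ?thesis .
qed

context stationary_rds
begin

text \<open>The gap between two starting times is small once \<open>s\<close> is large and the other time exceeds \<open>s\<close> by an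
  amount depending on \<open>s\<close>. Two late times are therefore compared through one common \<open>s\<close>.\<close>

lemma pullback_Cauchy:
  assumes mix: "strongly_mixing M \<phi> \<rho>" and stab: "weak_global_pointwise_stability M \<phi> \<rho>" and e: "0 < e"
  shows "\<exists>T\<ge>0. \<forall>t\<ge>T. \<forall>u\<ge>T. (\<integral>\<omega>. capped_dist (pullback x t \<omega>, pullback x u \<omega>) \<partial>M) < e"
proof -
  have "0 < e / 4" using e by simp
  from markov_mean_gap_small[OF mix stab this, of x] obtain S where S: "0 \<le> S"
    "\<And>s. S \<le> s \<Longrightarrow> \<exists>T\<ge>0. \<forall>r\<ge>T. markov_semigroup M \<phi> r (mean_gap s) x < e / 4 \<and> (\<integral>y. mean_gap s y \<partial>\<rho>) < e / 4"
    by blast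
  obtain S' where S': "\<And>s. S' \<le> s \<Longrightarrow> mean_gap s x < e / 4"
    using order_tendstoD(2)[OF mean_gap_tendsto_0[OF mix stab] \<open>0 < e / 4\<close>, of x]
    by (auto simp: eventually_at_top_linorder)
  define s where "s = max S S'"
  have s: "0 \<le> s" "S \<le> s" "S' \<le> s" using S(1) by (auto simp: s_def)
  obtain T where T: "0 \<le> T" "\<And>r. T \<le> r \<Longrightarrow> markov_semigroup M \<phi> r (mean_gap s) x < e / 4"
    using S(2)[OF s(2)] by blast
  have near: "(\<integral>\<omega>. capped_dist (pullback x t \<omega>, pullback x s \<omega>) \<partial>M) < e / 2" if "T + s \<le> t" for t
    using pullback_gap_le[of "t - s" s x] T(2)[of "t - s"] S'[OF s(3)] that s(1) T(1) by simp
  have "(\<integral>\<omega>. capped_dist (pullback x t \<omega>, pullback x u \<omega>) \<partial>M) < e" if "T + s \<le> t" "T + s \<le> u" for t u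
  proof -
    have "(\<integral>\<omega>. capped_dist (pullback x t \<omega>, pullback x u \<omega>) \<partial>M) \<le>
      (\<integral>\<omega>. capped_dist (pullback x t \<omega>, pullback x s \<omega>) \<partial>M) + (\<integral>\<omega>. capped_dist (pullback x s \<omega>, pullback x u \<omega>) \<partial>M)"
      using that s T by (intro mean_capped_dist_triangle pullback_measurable_M) auto
    also have "\<dots> < e"
      using near[OF that(1)] near[OF that(2)] by (simp add: capped_dist_commute[of "pullback x s _"])
    finally show ?thesis .
  qed
  then show ?thesis using s T by (intro exI[of _ "T + s"]) auto
qed

end

lemma summable_dist_imp_Cauchy:
  fixes f :: "nat \<Rightarrow> 'b::metric_space"
  assumes "summable (\<lambda>k. dist (f k) (f (Suc k)))"
  shows "Cauchy f"
proof (rule metric_CauchyI)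
  fix e :: real assume "0 < e"
  then obtain N where N: "\<And>m n. N \<le> m \<Longrightarrow> norm (\<Sum>k=m..<n. dist (f k) (f (Suc k))) < e"
    using assms unfolding summable_Cauchy by blast
  have le: "dist (f m) (f n) \<le> (\<Sum>k=m..<n. dist (f k) (f (Suc k)))" if "m \<le> n" for m n
    using that
  proof (induction n rule: dec_induct)
    case (step n)
    then show ?case using dist_triangle[of "f m" "f (Suc n)" "f n"] by simp
  qed simp
  have "dist (f m) (f n) < e" if "N \<le> m" "m \<le> n" for m n
    using le[OF that(2)] N[OF that(1), of n] by simp
  then show "\<exists>N. \<forall>m\<ge>N. \<forall>n\<ge>N. dist (f m) (f n) < e"
    by (metis dist_commute nle_le)
qed

text \<open>Completeness for convergence in probability, over a continuous time parameter. The limit is obtained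
  along a sequence \<open>u\<close> whose successive gaps have summable means; being a limit of functions measurable
  for \<open>N\<close>, it is itself measurable for \<open>N\<close>.\<close>

lemma (in prob_space) mean_Cauchy_imp_limit:
  fixes Y :: "real \<Rightarrow> 'a \<Rightarrow> 'b::polish_space"
  assumes N: "subalgebra M N" and Y: "\<And>t. 0 \<le> t \<Longrightarrow> Y t \<in> N \<rightarrow>\<^sub>M borel"
    and cauchy: "\<And>e. 0 < e \<Longrightarrow> \<exists>T\<ge>0. \<forall>t\<ge>T. \<forall>u\<ge>T. (\<integral>\<omega>. capped_dist (Y t \<omega>, Y u \<omega>) \<partial>M) < e"
  obtains a u where "a \<in> N \<rightarrow>\<^sub>M borel" "\<And>k::nat. 0 \<le> u k" "filterlim u at_top sequentially"
    "AE \<omega> in M. (\<lambda>k. Y (u k) \<omega>) \<longlonglongrightarrow> a \<omega>"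
    "((\<lambda>t. \<integral>\<omega>. capped_dist (Y t \<omega>, a \<omega>) \<partial>M) \<longlongrightarrow> 0) at_top"
proof -
  have YM: "Y t \<in> M \<rightarrow>\<^sub>M borel" if "0 \<le> t" for t
    by (rule measurable_from_subalg[OF N Y[OF that]])
  have "\<forall>k::nat. \<exists>T. 0 \<le> T \<and> (\<forall>t\<ge>T. \<forall>u\<ge>T. (\<integral>\<omega>. capped_dist (Y t \<omega>, Y u \<omega>) \<partial>M) < (1/2) ^ k)"
  proof
    fix k :: nat
    have "0 < (1/2 :: real) ^ k" by simp
    from cauchy[OF this] show "\<exists>T. 0 \<le> T \<and> (\<forall>t\<ge>T. \<forall>u\<ge>T. (\<integral>\<omega>. capped_dist (Y t \<omega>, Y u \<omega>) \<partial>M) < (1/2) ^ k)"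
      by blast
  qed
  then obtain T where T: "\<And>k::nat. 0 \<le> T k"
    "\<And>k t u. T k \<le> t \<Longrightarrow> T k \<le> u \<Longrightarrow> (\<integral>\<omega>. capped_dist (Y t \<omega>, Y u \<omega>) \<partial>M) < (1/2) ^ k"
    by metis
  \<comment> \<open>The partial sums dominate every \<open>T i\<close> with \<open>i \<le> k\<close>, increase, and exceed \<open>k\<close>.\<close>
  define u where "u k = (\<Sum>i\<le>k. T i + 1)" for k
  have uT: "T k \<le> u k" for k
  proof -
    have "T k \<le> T k + 1" by simp
    also have "\<dots> \<le> u k"
      unfolding u_def using T(1) by (intro member_le_sum) (auto intro: add_nonneg_nonneg)
    finally show ?thesis .
  qed
  have u0: "0 \<le> u k" for k using uT[of k] T(1)[of k] by simp
  have uk: "real k \<le> u k" for k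
  proof -
    have "(\<Sum>i\<le>k. 1 :: real) \<le> u k"
      unfolding u_def using T(1) by (intro sum_mono) simp
    then show ?thesis by simp
  qed
  have u_mono: "u k \<le> u n" if "k \<le> n" for k n
    unfolding u_def using that T(1) by (intro sum_mono2) (auto intro: add_nonneg_nonneg)
  have u_top: "filterlim u at_top sequentially"
    by (rule filterlim_at_top_mono[OF filterlim_real_sequentially]) (simp add: uk)
  have [measurable]: "Y (u k) \<in> N \<rightarrow>\<^sub>M borel" "Y (u k) \<in> M \<rightarrow>\<^sub>M borel" for k
    using Y YM u0 by auto
  have cm: "(\<lambda>\<omega>. capped_dist (f \<omega>, g \<omega>)) \<in> borel_measurable M"
    if [measurable]: "f \<in> borel_measurable M" "g \<in> borel_measurable M" for f g :: "'a \<Rightarrow> 'b"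
    unfolding capped_dist_def by measurable
  have ci: "integrable M (\<lambda>\<omega>. capped_dist (f \<omega>, g \<omega>))"
    if "f \<in> borel_measurable M" "g \<in> borel_measurable M" for f g :: "'a \<Rightarrow> 'b"
    using cm[OF that] by (intro integrable_const_bound[where B=1]) (simp_all add: capped_dist_bounds)
  have "(\<integral>\<^sup>+\<omega>. (\<Sum>k. ennreal (capped_dist (Y (u k) \<omega>, Y (u (Suc k)) \<omega>))) \<partial>M) =
      (\<Sum>k. \<integral>\<^sup>+\<omega>. ennreal (capped_dist (Y (u k) \<omega>, Y (u (Suc k)) \<omega>)) \<partial>M)"
    by (rule nn_integral_suminf) (use cm in measurable)
  also have "\<dots> = (\<Sum>k. ennreal (\<integral>\<omega>. capped_dist (Y (u k) \<omega>, Y (u (Suc k)) \<omega>) \<partial>M))"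
    by (intro suminf_cong nn_integral_eq_integral ci) (simp_all add: capped_dist_bounds)
  also have "\<dots> \<le> (\<Sum>k. ennreal ((1/2) ^ k))"
    using T(2)[OF uT order_trans[OF uT u_mono]] by (intro suminf_le ennreal_leI) (auto intro: less_imp_le)
  also have "\<dots> < \<infinity>"
    by (subst suminf_ennreal2) (auto intro!: summable_geometric)
  finally have "AE \<omega> in M. (\<Sum>k. ennreal (capped_dist (Y (u k) \<omega>, Y (u (Suc k)) \<omega>))) \<noteq> \<infinity>"
    by (intro nn_integral_noteq_infinite) (use cm in measurable)
  then have Cauchy: "AE \<omega> in M. Cauchy (\<lambda>k. Y (u k) \<omega>)"
  proof eventually_elim
    case (elim \<omega>)
    let ?c = "\<lambda>k. capped_dist (Y (u k) \<omega>, Y (u (Suc k)) \<omega>)"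
    have c: "summable ?c"
      using elim by (intro summable_suminf_not_top) (auto simp: capped_dist_bounds)
    then have "?c \<longlonglongrightarrow> 0" by (rule summable_LIMSEQ_zero)
    then have "\<forall>\<^sub>F k in sequentially. ?c k < 1" by (rule order_tendstoD) simp
    then have "\<forall>\<^sub>F k in sequentially. ?c k = dist (Y (u k) \<omega>) (Y (u (Suc k)) \<omega>)"
      by eventually_elim (auto simp: capped_dist_def min_def split: if_splits)
    from summable_cong[OF this] c show ?case by (intro summable_dist_imp_Cauchy) simp
  qed
  \<comment> \<open>On the null set of divergence any fixed value will do; the case distinction keeps \<open>a\<close> measurable.\<close>
  define a where "a \<omega> = lim (\<lambda>k. if Cauchy (\<lambda>k. Y (u k) \<omega>) then Y (u k) \<omega> else undefined)" for \<omega>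
  have lim_a: "(\<lambda>k. if Cauchy (\<lambda>k. Y (u k) \<omega>) then Y (u k) \<omega> else undefined) \<longlonglongrightarrow> a \<omega>" for \<omega>
    unfolding a_def
    by (cases "Cauchy (\<lambda>k. Y (u k) \<omega>)") (auto simp: convergent_LIMSEQ_iff[symmetric] Cauchy_convergent_iff[symmetric] convergent_const)
  have a: "a \<in> N \<rightarrow>\<^sub>M borel"
    by (rule borel_measurable_LIMSEQ_metric[OF _ lim_a]) measurable
  then have [measurable]: "a \<in> M \<rightarrow>\<^sub>M borel" by (rule measurable_from_subalg[OF N])
  have conv: "AE \<omega> in M. (\<lambda>k. Y (u k) \<omega>) \<longlonglongrightarrow> a \<omega>"
    using Cauchy
  proof eventually_elim
    case (elim \<omega>)
    then show ?case using lim_a[of \<omega>] by simp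
  qed
  have le: "(\<integral>\<omega>. capped_dist (Y t \<omega>, a \<omega>) \<partial>M) \<le> (1/2) ^ k" if "u k \<le> t" for t k
  proof (rule LIMSEQ_le_const2)
    have t: "0 \<le> t" using u0[of k] that by simp
    note [measurable] = YM[OF t]
    show "(\<lambda>n. \<integral>\<omega>. capped_dist (Y t \<omega>, Y (u n) \<omega>) \<partial>M) \<longlonglongrightarrow> (\<integral>\<omega>. capped_dist (Y t \<omega>, a \<omega>) \<partial>M)"
    proof (rule integral_dominated_convergence[where w="\<lambda>_. 1"])
      show "AE \<omega> in M. (\<lambda>n. capped_dist (Y t \<omega>, Y (u n) \<omega>)) \<longlonglongrightarrow> capped_dist (Y t \<omega>, a \<omega>)"
        using conv
      proof eventually_elim
        case (elim \<omega>)
        then show ?case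
          by (intro continuous_on_tendsto_compose[OF capped_dist_continuous] tendsto_Pair tendsto_const) auto
      qed
    qed (use cm in \<open>auto simp: capped_dist_bounds\<close>)
    show "\<exists>N. \<forall>n\<ge>N. (\<integral>\<omega>. capped_dist (Y t \<omega>, Y (u n) \<omega>) \<partial>M) \<le> (1/2) ^ k"
      using T(2)[OF order_trans[OF uT that] order_trans[OF uT u_mono]] by (intro exI[of _ k]) (auto intro: less_imp_le)
  qed
  have "((\<lambda>t. \<integral>\<omega>. capped_dist (Y t \<omega>, a \<omega>) \<partial>M) \<longlongrightarrow> 0) at_top"
  proof (rule order_tendstoI)
    fix e :: real assume "e < 0"
    then show "\<forall>\<^sub>F t in at_top. e < (\<integral>\<omega>. capped_dist (Y t \<omega>, a \<omega>) \<partial>M)"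
      by (intro always_eventually allI less_le_trans[OF _ Bochner_Integration.integral_nonneg]) (simp_all add: capped_dist_bounds)
  next
    fix e :: real assume "0 < e"
    then obtain k where k: "(1/2) ^ k < e" using real_arch_pow_inv[of e "1/2"] by auto
    show "\<forall>\<^sub>F t in at_top. (\<integral>\<omega>. capped_dist (Y t \<omega>, a \<omega>) \<partial>M) < e"
      using eventually_ge_at_top[of "u k"]
      by eventually_elim (rule le_less_trans[OF le k])
  qed
  with a u0 u_top conv show thesis by (rule that)
qed

lemma (in prob_space) mean_capped_dist_imp_in_prob:
  fixes X :: "real \<Rightarrow> 'a \<Rightarrow> 'b::{metric_space,second_countable_topology}"
  assumes X: "\<And>t. 0 \<le> t \<Longrightarrow> X t \<in> borel_measurable M" and [measurable]: "a \<in> borel_measurable M"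
    and lim: "((\<lambda>t. \<integral>\<omega>. capped_dist (X t \<omega>, a \<omega>) \<partial>M) \<longlongrightarrow> 0) at_top"
  shows "tendsto_in_prob M (\<lambda>t \<omega>. dist (X t \<omega>) (a \<omega>)) 0 at_top"
  unfolding tendsto_in_prob_def
proof (intro allI impI)
  fix \<epsilon> :: real assume \<epsilon>: "0 < \<epsilon>"
  define c where "c = min 1 \<epsilon>"
  have c: "0 < c" using \<epsilon> by (simp add: c_def)
  show "((\<lambda>t. measure M {\<omega> \<in> space M. \<bar>dist (X t \<omega>) (a \<omega>) - 0\<bar> > \<epsilon>}) \<longlongrightarrow> 0) at_top"
  proof (rule tendsto_sandwich[OF _ _ tendsto_const])
    show "((\<lambda>t. (\<integral>\<omega>. capped_dist (X t \<omega>, a \<omega>) \<partial>M) / c) \<longlongrightarrow> 0) at_top"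
      using tendsto_divide[OF lim tendsto_const[of c]] c by simp
    show "\<forall>\<^sub>F t in at_top. measure M {\<omega> \<in> space M. \<bar>dist (X t \<omega>) (a \<omega>) - 0\<bar> > \<epsilon>} \<le> (\<integral>\<omega>. capped_dist (X t \<omega>, a \<omega>) \<partial>M) / c"
      using eventually_ge_at_top[of 0]
    proof eventually_elim
      case (elim t)
      note [measurable] = X[OF elim]
      have [measurable]: "(\<lambda>\<omega>. capped_dist (X t \<omega>, a \<omega>)) \<in> borel_measurable M"
        unfolding capped_dist_def by measurable
      have "measure M {\<omega> \<in> space M. \<bar>dist (X t \<omega>) (a \<omega>) - 0\<bar> > \<epsilon>} \<le> measure M {\<omega> \<in> space M. c \<le> capped_dist (X t \<omega>, a \<omega>)}"
        by (rule finite_measure_mono) (auto simp: c_def capped_dist_def)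
      also have "\<dots> \<le> (\<integral>\<omega>. capped_dist (X t \<omega>, a \<omega>) \<partial>M) / c"
        by (rule integral_Markov_inequality_measure[where A="{}"])
          (use c in \<open>auto intro!: integrable_const_bound[where B=1] simp: capped_dist_bounds\<close>)
      finally show ?case .
    qed
  qed simp
qed

context white_noise_rds
begin

lemma past_subalgebra: "subalgebra M (past M F 0)"
  and noise_subalgebra_past: "0 \<le> t \<Longrightarrow> subalgebra (past M F 0) (F (- t) 0)"
proof -
  have sub: "(\<Union>s\<in>{..0}. sets (F s 0)) \<subseteq> sets M"
    using noise_subalgebra[of _ 0] by (auto simp: subalgebra_def)
  then have pow: "(\<Union>s\<in>{..0}. sets (F s 0)) \<subseteq> Pow (space M)"
    using sets.sets_into_space by blast
  show "subalgebra M (past M F 0)"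
    unfolding subalgebra_def past_def space_measure_of[OF pow] sets_measure_of[OF pow]
    using sets.sigma_sets_subset[OF sub] by simp
  show "subalgebra (past M F 0) (F (- t) 0)" if "0 \<le> t"
  proof -
    have "sets (F (- t) 0) \<subseteq> (\<Union>s\<in>{..0}. sets (F s 0))" using that by force
    then have "sets (F (- t) 0) \<subseteq> sigma_sets (space M) (\<Union>s\<in>{..0}. sets (F s 0))"
      by (auto intro: sigma_sets.Basic)
    then show ?thesis
      using noise_subalgebra[of "- t" 0] that
      unfolding subalgebra_def past_def space_measure_of[OF pow] sets_measure_of[OF pow] by simp
  qed
qed

end

context stationary_rds
begin

lemma pullback_pair_gap_tendsto_0:
  assumes mix: "strongly_mixing M \<phi> \<rho>" and stab: "weak_global_pointwise_stability M \<phi> \<rho>"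
  shows "((\<lambda>t. \<integral>\<omega>. capped_dist (pullback x t \<omega>, pullback y t \<omega>) \<partial>M) \<longlongrightarrow> 0) at_top"
proof (rule tendsto_sandwich[OF _ _ tendsto_const])
  show "((\<lambda>t. mean_gap t x + mean_gap t y) \<longlongrightarrow> 0) at_top"
    using tendsto_add[OF mean_gap_tendsto_0[OF mix stab] mean_gap_tendsto_0[OF mix stab]] by simp
  show "\<forall>\<^sub>F t in at_top. (\<integral>\<omega>. capped_dist (pullback x t \<omega>, pullback y t \<omega>) \<partial>M) \<le> mean_gap t x + mean_gap t y"
    using eventually_ge_at_top[of 0]
  proof eventually_elim
    case (elim t)
    have "(\<lambda>\<omega>. capped_dist (\<phi> t \<omega> x, \<phi> t \<omega> y)) \<in> borel_measurable M"
      using elim by measurable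
    from integral_flow[OF this, of "- t"]
    have "(\<integral>\<omega>. capped_dist (pullback x t \<omega>, pullback y t \<omega>) \<partial>M) = P2 t capped_dist (x, y)"
      by (simp add: pullback_def two_point_semigroup_def)
    then show ?case using pair_gap_le_mean_gap[OF elim, of x y] by simp
  qed
qed (simp add: capped_dist_bounds)

text \<open>Pushing the pullback from \<open>- s\<close> forward by \<open>t\<close> gives the pullback of duration \<open>t + s\<close> seen at \<open>\<theta> t \<omega>\<close>.
  As \<open>s\<close> runs through \<open>u\<close>, one side converges almost surely by continuity of the flow map, the other
  in mean because \<open>\<theta> t\<close> preserves the measure; so the mean distance of the two limits is \<open>0\<close>.\<close>

lemma pullback_limit_equivariant:
  assumes a[measurable]: "a \<in> M \<rightarrow>\<^sub>M borel" and u: "\<And>k::nat. 0 \<le> u k" "filterlim u at_top sequentially"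
    and conv: "AE \<omega> in M. (\<lambda>k. pullback x (u k) \<omega>) \<longlonglongrightarrow> a \<omega>"
    and mean: "((\<lambda>t. \<integral>\<omega>. capped_dist (pullback x t \<omega>, a \<omega>) \<partial>M) \<longlongrightarrow> 0) at_top"
    and t: "0 \<le> t"
  shows "AE \<omega> in M. \<phi> t \<omega> (a \<omega>) = a (\<theta> t \<omega>)"
proof -
  have [measurable]: "pullback x (u k) \<in> M \<rightarrow>\<^sub>M borel" for k by (rule pullback_measurable_M[OF u(1)])
  have cm: "(\<lambda>\<omega>. capped_dist (f \<omega>, g \<omega>)) \<in> borel_measurable M"
    if [measurable]: "f \<in> borel_measurable M" "g \<in> borel_measurable M" for f g :: "'w \<Rightarrow> 'e"
    unfolding capped_dist_def by measurable
  have push [measurable]: "(\<lambda>\<omega>. \<phi> t \<omega> (f \<omega>)) \<in> M \<rightarrow>\<^sub>M borel" if "f \<in> M \<rightarrow>\<^sub>M borel" for f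
    using that t by measurable
  let ?e = "\<integral>\<omega>. capped_dist (\<phi> t \<omega> (a \<omega>), a (\<theta> t \<omega>)) \<partial>M"
  have "?e \<le> (\<integral>\<omega>. capped_dist (\<phi> t \<omega> (a \<omega>), \<phi> t \<omega> (pullback x (u k) \<omega>)) \<partial>M) +
      (\<integral>\<omega>. capped_dist (pullback x (t + u k) \<omega>, a \<omega>) \<partial>M)" for k
  proof -
    have [measurable]: "pullback x (t + u k) \<in> M \<rightarrow>\<^sub>M borel"
      using t u(1) by (intro pullback_measurable_M) simp
    have eq: "\<phi> t \<omega> (pullback x (u k) \<omega>) = pullback x (t + u k) (\<theta> t \<omega>)" if \<omega>: "\<omega> \<in> space M" for \<omega>
    proof -
      have \<omega>': "\<theta> (- u k) \<omega> \<in> space M" by (rule measurable_space[OF flow_measurable_at \<omega>])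
      have "\<theta> (- (t + u k)) (\<theta> t \<omega>) = \<theta> (- u k) \<omega>"
        using flow_add[OF \<omega>, of "- (t + u k)" t] by simp
      moreover have "\<theta> (u k) (\<theta> (- u k) \<omega>) = \<omega>"
        using flow_add[OF \<omega>, of "u k" "- u k"] flow_zero[OF \<omega>] by simp
      ultimately show ?thesis
        using cocycle_add[OF u(1)[of k] t \<omega>', of x] by (simp add: pullback_def)
    qed
    have "?e \<le> (\<integral>\<omega>. capped_dist (\<phi> t \<omega> (a \<omega>), \<phi> t \<omega> (pullback x (u k) \<omega>)) \<partial>M) +
        (\<integral>\<omega>. capped_dist (\<phi> t \<omega> (pullback x (u k) \<omega>), a (\<theta> t \<omega>)) \<partial>M)"
      by (rule mean_capped_dist_triangle) measurable
    also have "(\<integral>\<omega>. capped_dist (\<phi> t \<omega> (pullback x (u k) \<omega>), a (\<theta> t \<omega>)) \<partial>M) =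
        (\<integral>\<omega>. capped_dist (pullback x (t + u k) (\<theta> t \<omega>), a (\<theta> t \<omega>)) \<partial>M)"
      by (intro Bochner_Integration.integral_cong refl) (simp add: eq)
    also have "\<dots> = (\<integral>\<omega>. capped_dist (pullback x (t + u k) \<omega>, a \<omega>) \<partial>M)"
      by (rule integral_flow[OF cm]) measurable
    finally show ?thesis .
  qed
  moreover have "(\<lambda>k. (\<integral>\<omega>. capped_dist (\<phi> t \<omega> (a \<omega>), \<phi> t \<omega> (pullback x (u k) \<omega>)) \<partial>M) +
      (\<integral>\<omega>. capped_dist (pullback x (t + u k) \<omega>, a \<omega>) \<partial>M)) \<longlonglongrightarrow> 0 + 0"
  proof (rule tendsto_add)
    have "(\<lambda>k. \<integral>\<omega>. capped_dist (\<phi> t \<omega> (a \<omega>), \<phi> t \<omega> (pullback x (u k) \<omega>)) \<partial>M) \<longlonglongrightarrow> (\<integral>\<omega>. 0 \<partial>M)"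
    proof (rule integral_dominated_convergence[where w="\<lambda>_. 1"])
      show "AE \<omega> in M. (\<lambda>k. capped_dist (\<phi> t \<omega> (a \<omega>), \<phi> t \<omega> (pullback x (u k) \<omega>))) \<longlonglongrightarrow> 0"
        using conv AE_space
      proof eventually_elim
        case (elim \<omega>)
        have "(\<lambda>k. \<phi> t \<omega> (pullback x (u k) \<omega>)) \<longlonglongrightarrow> \<phi> t \<omega> (a \<omega>)"
          by (rule continuous_on_tendsto_compose[OF cocycle_continuous[OF t elim(2)] elim(1)]) auto
        then have "(\<lambda>k. capped_dist (\<phi> t \<omega> (a \<omega>), \<phi> t \<omega> (pullback x (u k) \<omega>))) \<longlonglongrightarrow>
            capped_dist (\<phi> t \<omega> (a \<omega>), \<phi> t \<omega> (a \<omega>))"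
          by (intro continuous_on_tendsto_compose[OF capped_dist_continuous] tendsto_Pair tendsto_const) auto
        then show ?case unfolding iffD2[OF capped_dist_eq_0 refl] .
      qed
      show "(\<lambda>\<omega>. capped_dist (\<phi> t \<omega> (a \<omega>), \<phi> t \<omega> (pullback x (u k) \<omega>))) \<in> borel_measurable M" for k
        by (rule cm) measurable
    qed (auto simp: capped_dist_bounds)
    then show "(\<lambda>k. \<integral>\<omega>. capped_dist (\<phi> t \<omega> (a \<omega>), \<phi> t \<omega> (pullback x (u k) \<omega>)) \<partial>M) \<longlonglongrightarrow> 0" by simp
    show "(\<lambda>k. \<integral>\<omega>. capped_dist (pullback x (t + u k) \<omega>, a \<omega>) \<partial>M) \<longlonglongrightarrow> 0"
      by (rule filterlim_compose[OF mean filterlim_tendsto_add_at_top[OF tendsto_const u(2)]])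
  qed
  ultimately have "?e \<le> 0"
    by (intro LIMSEQ_le_const[of _ 0]) auto
  moreover have "0 \<le> ?e" by (simp add: capped_dist_bounds)
  ultimately have "?e = 0" by simp
  moreover have "integrable M (\<lambda>\<omega>. capped_dist (\<phi> t \<omega> (a \<omega>), a (\<theta> t \<omega>)))"
  proof (rule integrable_const_bound[where B=1])
    show "(\<lambda>\<omega>. capped_dist (\<phi> t \<omega> (a \<omega>), a (\<theta> t \<omega>))) \<in> borel_measurable M"
      by (rule cm) measurable
  qed (simp add: capped_dist_bounds)
  ultimately have "AE \<omega> in M. capped_dist (\<phi> t \<omega> (a \<omega>), a (\<theta> t \<omega>)) = 0"
    by (subst (asm) integral_nonneg_eq_0_iff_AE) (simp_all add: capped_dist_bounds)
  then show ?thesis by simp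
qed

lemma weak_synchronization_of_stability:
  assumes mix: "strongly_mixing M \<phi> \<rho>" and stab: "weak_global_pointwise_stability M \<phi> \<rho>"
  shows "weak_synchronization M \<theta> \<phi> F"
proof -
  \<comment> \<open>The limit is constructed from one reference point; all other points follow it.\<close>
  fix x0 :: 'e
  have Y: "pullback x0 t \<in> past M F 0 \<rightarrow>\<^sub>M borel" if "0 \<le> t" for t
    by (rule measurable_from_subalg[OF noise_subalgebra_past pullback_measurable]) (use that in auto)
  obtain a u where a: "a \<in> past M F 0 \<rightarrow>\<^sub>M borel" and u: "\<And>k::nat. 0 \<le> u k" "filterlim u at_top sequentially"
    and conv: "AE \<omega> in M. (\<lambda>k. pullback x0 (u k) \<omega>) \<longlonglongrightarrow> a \<omega>"
    and mean: "((\<lambda>t. \<integral>\<omega>. capped_dist (pullback x0 t \<omega>, a \<omega>) \<partial>M) \<longlongrightarrow> 0) at_top"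
    by (rule mean_Cauchy_imp_limit[OF past_subalgebra Y pullback_Cauchy[OF mix stab]]) blast+
  have aM: "a \<in> M \<rightarrow>\<^sub>M borel" by (rule measurable_from_subalg[OF past_subalgebra a])
  have "tendsto_in_prob M (\<lambda>t \<omega>. dist (pullback x t \<omega>) (a \<omega>)) 0 at_top" for x
  proof (rule mean_capped_dist_imp_in_prob[OF pullback_measurable_M aM])
    show "((\<lambda>t. \<integral>\<omega>. capped_dist (pullback x t \<omega>, a \<omega>) \<partial>M) \<longlongrightarrow> 0) at_top"
    proof (rule tendsto_sandwich[OF _ _ tendsto_const])
      show "((\<lambda>t. (\<integral>\<omega>. capped_dist (pullback x t \<omega>, pullback x0 t \<omega>) \<partial>M) +
          (\<integral>\<omega>. capped_dist (pullback x0 t \<omega>, a \<omega>) \<partial>M)) \<longlongrightarrow> 0) at_top"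
        using tendsto_add[OF pullback_pair_gap_tendsto_0[OF mix stab] mean] by simp
      show "\<forall>\<^sub>F t in at_top. (\<integral>\<omega>. capped_dist (pullback x t \<omega>, a \<omega>) \<partial>M) \<le>
          (\<integral>\<omega>. capped_dist (pullback x t \<omega>, pullback x0 t \<omega>) \<partial>M) + (\<integral>\<omega>. capped_dist (pullback x0 t \<omega>, a \<omega>) \<partial>M)"
        using eventually_ge_at_top[of 0]
        by eventually_elim (intro mean_capped_dist_triangle pullback_measurable_M aM)
    qed (simp add: capped_dist_bounds)
  qed
  then show ?thesis
    unfolding weak_synchronization_def pullback_def
    using a pullback_limit_equivariant[OF aM u conv mean] by blast
qed

end

theorem theorem4:
  fixes M :: "'w measure"
    and \<theta> :: "real \<Rightarrow> 'w \<Rightarrow> 'w"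
    and \<phi> :: "real \<Rightarrow> 'w \<Rightarrow> 'e::polish_space \<Rightarrow> 'e"
    and F :: "real \<Rightarrow> real \<Rightarrow> 'w measure"
    and \<rho> :: "'e measure"
  assumes "white_noise_rds M \<theta> \<phi> F"
    and "invariant_prob M \<phi> \<rho>"
    and "strongly_mixing M \<phi> \<rho>"
    and "weak_global_pointwise_stability M \<phi> \<rho>"
  shows "weak_synchronization M \<theta> \<phi> F"
proof -
  interpret stationary_rds M \<theta> \<phi> F \<rho>
    using assms(1,2) by (simp add: stationary_rds_def stationary_rds_axioms_def)
  show ?thesis by (rule weak_synchronization_of_stability[OF assms(3,4)])
qed

end
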